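(* Let $d \ge 2$ and let $F \in M_b(\mathbb{R}^d;\mathbb{R}^d)$ be a finite $\mathbb{R}^d$-valued Radon measure such that $\operatorname{div} F = 0$ in the sense of distributions. Then there exist positive integers $n_l$ ($l \in \mathbb{N}$) and $C^1$ closed curves $\Gamma_{i,l}$, $i \in \{1,\dots,n_l\}$, $l \in \mathbb{N}$, with parameterizations by arclength $\gamma_{i,l} \in C^1([0,L_{i,l}];\mathbb{R}^d)$ (so $|\dot\gamma_{i,l}| \equiv 1$ and $|\Gamma_{i,l}| = L_{i,l}$), where $l \le L_{i,l} \le 2l$, such that \[ F = \lim_{l \to \infty} \frac{\|F\|_{M_b(\mathbb{R}^d;\mathbb{R}^d)}}{n_l \cdot l} \sum_{i=1}^{n_l} \dot{\gamma}_{i,l}\, \mathcal{H}^1\llcorner \Gamma_{i,l} \] weakly-star in the sense of measures (i.e. when tested against every $\Phi \in C_0(\mathbb{R}^d;\mathbb{R}^d)$), and \[ \lim_{l \to \infty} \frac{1}{n_l \cdot l} \sum_{i=1}^{n_l} |\Gamma_{i,l}| = 1. \]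
   Context: $M_b(\mathbb{R}^d;\mathbb{R}^d)$ denotes the space of finite $\mathbb{R}^d$-valued Radon measures on $\mathbb{R}^d$ with the total variation norm $\|\cdot\|_{M_b(\mathbb{R}^d;\mathbb{R}^d)}$, identified with the dual of $C_0(\mathbb{R}^d;\mathbb{R}^d)$ (continuous vector fields vanishing at infinity with the sup norm). For a closed curve $\Gamma$ parametrized by arclength via $\gamma:[0,L]\to\mathbb{R}^d$, $\dot\gamma\,\mathcal{H}^1\llcorner\Gamma$ denotes the vector measure acting by $\Phi \mapsto \int_0^L \dot\gamma(t)\cdot\Phi(\gamma(t))\,dt$ for $\Phi \in C_0(\mathbb{R}^d;\mathbb{R}^d)$; $|\Gamma|$ denotes the length of $\Gamma$. $\operatorname{div} F = 0$ in the sense of distributions means $\int \nabla\varphi \cdot dF = 0$ for all $\varphi \in C_c^\infty(\mathbb{R}^d)$. *)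

theory Defs
  imports "HOL-Analysis.Analysis"
begin

definition C0_fields :: "('a::euclidean_space \<Rightarrow> 'a) set" where
  "C0_fields = {\<Phi>. continuous_on UNIV \<Phi> \<and> (\<Phi> \<longlongrightarrow> 0) at_infinity}"

definition sup_norm :: "('a::euclidean_space \<Rightarrow> 'a) \<Rightarrow> real" where
  "sup_norm \<Phi> = (SUP x. norm (\<Phi> x))"

(* Finite R^d-valued Radon measures, identified with the dual of C_0(R^d;R^d):
   bounded linear functionals on C0_fields (values outside C0_fields are irrelevant). *)
definition vector_radon_measure :: "(('a::euclidean_space \<Rightarrow> 'a) \<Rightarrow> real) \<Rightarrow> bool" where
  "vector_radon_measure F \<longleftrightarrow>
     (\<forall>\<Phi>\<in>C0_fields. \<forall>\<Psi>\<in>C0_fields. F (\<lambda>x. \<Phi> x + \<Psi> x) = F \<Phi> + F \<Psi>) \<and>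
     (\<forall>\<Phi>\<in>C0_fields. \<forall>c::real. F (\<lambda>x. c *\<^sub>R \<Phi> x) = c * F \<Phi>) \<and>
     (\<exists>B. \<forall>\<Phi>\<in>C0_fields. \<bar>F \<Phi>\<bar> \<le> B * sup_norm \<Phi>)"

(* total variation norm = dual norm *)
definition measure_norm :: "(('a::euclidean_space \<Rightarrow> 'a) \<Rightarrow> real) \<Rightarrow> real" where
  "measure_norm F = Sup {\<bar>F \<Phi>\<bar> | \<Phi>. \<Phi> \<in> C0_fields \<and> sup_norm \<Phi> \<le> 1}"

fun iter_dderiv :: "('a::euclidean_space \<Rightarrow> real) \<Rightarrow> 'a list \<Rightarrow> 'a \<Rightarrow> real" where
  "iter_dderiv f [] = f"
| "iter_dderiv f (v # vs) = (\<lambda>x. frechet_derivative (iter_dderiv f vs) (at x) v)"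

definition smooth_fun :: "('a::euclidean_space \<Rightarrow> real) \<Rightarrow> bool" where
  "smooth_fun f \<longleftrightarrow> (\<forall>vs. set vs \<subseteq> Basis \<longrightarrow> (\<forall>x. iter_dderiv f vs differentiable (at x)))"

definition test_fun :: "('a::euclidean_space \<Rightarrow> real) \<Rightarrow> bool" where
  "test_fun \<phi> \<longleftrightarrow> smooth_fun \<phi> \<and> compact (closure {x. \<phi> x \<noteq> 0})"

definition grad :: "('a::euclidean_space \<Rightarrow> real) \<Rightarrow> 'a \<Rightarrow> 'a" where
  "grad \<phi> x = (\<Sum>b\<in>Basis. frechet_derivative \<phi> (at x) b *\<^sub>R b)"

definition div_free :: "(('a::euclidean_space \<Rightarrow> 'a) \<Rightarrow> real) \<Rightarrow> bool" where
  "div_free F \<longleftrightarrow> (\<forall>\<phi>. test_fun \<phi> \<longrightarrow> F (grad \<phi>) = 0)"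

definition arclength_C1_closed_curve :: "(real \<Rightarrow> 'a::euclidean_space) \<Rightarrow> real \<Rightarrow> bool" where
  "arclength_C1_closed_curve \<gamma> L \<longleftrightarrow> 0 < L \<and>
     (\<exists>\<gamma>'. (\<forall>t\<in>{0..L}. (\<gamma> has_vector_derivative \<gamma>' t) (at t within {0..L})) \<and>
           continuous_on {0..L} \<gamma>' \<and>
           (\<forall>t\<in>{0..L}. norm (\<gamma>' t) = 1) \<and>
           \<gamma> 0 = \<gamma> L \<and> \<gamma>' 0 = \<gamma>' L)"

(* action of the vector measure  gamma' H^1 restricted to Gamma  on a test field Phi *)
definition curve_measure :: "(real \<Rightarrow> 'a::euclidean_space) \<Rightarrow> real \<Rightarrow> ('a \<Rightarrow> 'a) \<Rightarrow> real" where
  "curve_measure \<gamma> L \<Phi> =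
     integral {0..L} (\<lambda>t. vector_derivative \<gamma> (at t within {0..L}) \<bullet> \<Phi> (\<gamma> t))"

end

theory Submission
  imports Defs
begin

text \<open>Let \<open>M\<close> be the supremum of \<open>\<integral> \<Phi> \<cdot> d\<gamma>\<close> per unit length over closed curves. As in weak KAM theory,
  the maximal value of \<open>\<integral> \<Phi> \<cdot> d\<gamma> - M length\<close> over curves from a base point is a potential \<open>\<phi>\<close> with
  \<open>\<bar>\<nabla>\<phi> - \<Phi>\<bar> \<le> M\<close>. Since \<open>F\<close> annihilates gradients, \<open>F \<Phi> \<le> \<parallel>F\<parallel> M\<close>: for each single test field some
  closed curve does at least as well as \<open>F\<close>, and repeating it and padding it with curves of zero
  displacement gives any prescribed large length. Choosing curves greedily against the accumulated error
  turns these one-sided bounds into uniform averages that converge on finitely many fields, and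
  separability of \<open>C\<^sub>0\<close> with a diagonal choice finishes the proof. All curves at stage \<open>l\<close> have
  length exactly \<open>l\<close>.\<close>

text \<open>The obstacle is a gap in regularity on both sides. Closed curves must be C^1 with unit
  speed and equal end directions, while a potential is easiest to build from polygonal paths. So the
  supremum is taken over discrete chains of short steps and corners are repaired afterwards: in
  dimension at least 2 any direction can be turned into any other by an arbitrarily short arc that
  returns to its starting point, so a corner costs as little length and integral as desired. In
  dimension 1 a closed C^1 curve of unit speed does not even exist. On the other side the potential
  is merely continuous and need not decay, whereas \<open>div_free\<close> tests smooth functions of
  compact support; hence the cut-off and the mollification. The bound for one field is strong
  because it applies to every linear combination of fields: whatever error vector has accumulated,
  some curve does not push further along it. The length from which this works depends on the
  combination, so it is first made uniform over bounded coefficients by rounding them to a finite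
  grid.\<close>

subsection \<open>Arcs with prescribed end directions\<close>

text \<open>A unit-speed \<open>C\<^sup>1\<close> arc of length \<open>L\<close> from \<open>x\<close> with direction \<open>a\<close> to \<open>y\<close> with direction
  \<open>b\<close>, whose line integral of \<open>\<Phi>\<close> is \<open>I\<close>.\<close>
definition C1_arc :: "('a::euclidean_space \<Rightarrow> 'a) \<Rightarrow> 'a \<Rightarrow> 'a \<Rightarrow> 'a \<Rightarrow> 'a \<Rightarrow> real \<Rightarrow> real \<Rightarrow> bool" where
  "C1_arc \<Phi> x a y b L I \<longleftrightarrow> 0 < L \<and>
     (\<exists>\<gamma> \<gamma>'. (\<forall>t\<in>{0..L}. (\<gamma> has_vector_derivative \<gamma>' t) (at t within {0..L})) \<and>
           continuous_on {0..L} \<gamma>' \<and> (\<forall>t\<in>{0..L}. norm (\<gamma>' t) = 1) \<and>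
           \<gamma> 0 = x \<and> \<gamma> L = y \<and> \<gamma>' 0 = a \<and> \<gamma>' L = b \<and>
           ((\<lambda>t. \<gamma>' t \<bullet> \<Phi> (\<gamma> t)) has_integral I) {0..L})"

lemma C1_arc_pos: "C1_arc \<Phi> x a y b L I \<Longrightarrow> 0 < L"
  by (simp add: C1_arc_def)

lemma C1_arcE:
  assumes "C1_arc \<Phi> x a y b L I"
  obtains g g' where "0 < L" "\<forall>t\<in>{0..L}. (g has_vector_derivative g' t) (at t within {0..L})"
    "continuous_on {0..L} g'" "\<forall>t\<in>{0..L}. norm (g' t) = 1"
    "g 0 = x" "g L = y" "g' 0 = a" "g' L = b" "((\<lambda>t. g' t \<bullet> \<Phi> (g t)) has_integral I) {0..L}"
  using assms unfolding C1_arc_def by (elim conjE exE) (rule that)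

lemma closed_curveE:
  assumes "arclength_C1_closed_curve \<gamma> L"
  obtains g' where "0 < L" "\<forall>t\<in>{0..L}. (\<gamma> has_vector_derivative g' t) (at t within {0..L})"
    "continuous_on {0..L} g'" "\<forall>t\<in>{0..L}. norm (g' t) = 1"
  using assms unfolding arclength_C1_closed_curve_def
  by (elim conjE exE) (rule that)

text \<open>The glued curve is C^1 because the position \<open>y\<close> and the direction
  \<open>b\<close> agree at the joint; recording the end directions in \<open>C1_arc\<close> is what
  makes arcs composable.\<close>

lemma C1_arc_join:
  assumes A: "C1_arc \<Phi> x a y b L I" and B: "C1_arc \<Phi> y b z c M J"
  shows "C1_arc \<Phi> x a z c (L + M) (I + J)"
proof -
  obtain g g' where L: "0 < L" and g: "\<forall>t\<in>{0..L}. (g has_vector_derivative g' t) (at t within {0..L})"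
    "continuous_on {0..L} g'" "\<forall>t\<in>{0..L}. norm (g' t) = 1"
    "g 0 = x" "g L = y" "g' 0 = a" "g' L = b" "((\<lambda>t. g' t \<bullet> \<Phi> (g t)) has_integral I) {0..L}"
    using A by (rule C1_arcE)
  note g = g[rule_format]
  obtain h h' where M: "0 < M" and h: "\<forall>t\<in>{0..M}. (h has_vector_derivative h' t) (at t within {0..M})"
    "continuous_on {0..M} h'" "\<forall>t\<in>{0..M}. norm (h' t) = 1"
    "h 0 = y" "h M = z" "h' 0 = b" "h' M = c" "((\<lambda>t. h' t \<bullet> \<Phi> (h t)) has_integral J) {0..M}"
    using B by (rule C1_arcE)
  note h = h[rule_format]
  define k where "k t = (if t \<in> {0..L} then g t else h (t - L))" for t
  define k' where "k' t = (if t \<in> {0..L} then g' t else h' (t - L))" for t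
  have sh: "((\<lambda>t. h (t - L)) has_vector_derivative h' (t - L)) (at t within {L..L+M})" if "t \<in> {L..L+M}" for t
  proof -
    have im: "(\<lambda>t. t - L) ` {L..L+M} = {0..M}"
      using image_add_atLeastAtMost[of "-L" L "L+M"] by simp
    have 1: "((\<lambda>t. t - L) has_vector_derivative 1) (at t within {L..L+M})"
      by (auto intro!: derivative_eq_intros)
    have "(h \<circ> (\<lambda>t. t - L) has_vector_derivative 1 *\<^sub>R h' (t - L)) (at t within {L..L+M})"
      by (rule vector_diff_chain_within[OF 1]) (use that h(1)[of "t-L"] im in auto)
    then show ?thesis by (simp add: o_def)
  qed
  have cl: "{0..L} \<union> (closure {0..L} \<inter> closure {L..L+M}) = {0..L}"
    "{L..L+M} \<union> (closure {0..L} \<inter> closure {L..L+M}) = {L..L+M}" "{0..L+M} = {0..L} \<union> {L..L+M}"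
    "closure {0..L} \<inter> closure {L..L+M} = {L}"
    using L M by auto
  have d: "(k has_vector_derivative k' t) (at t within {0..L+M})" if "t \<in> {0..L+M}" for t
    unfolding k_def[abs_def] k'_def
  proof (rule has_vector_derivative_If_within_closures[where T = "{L..L+M}"], goal_cases)
    case 1 then show ?case using that cl by simp
  next case 2 then show ?case using cl(3) by simp
  next case 3 then show ?case unfolding cl(1) by (rule g(1))
  next case 4 then show ?case unfolding cl(2) by (rule sh)
  next case 5 then have "t = L" using cl(4) by blast then show ?case using g h by simp
  next case 6 then have "t = L" using cl(4) by blast then show ?case using g h by simp
  qed
  have c: "continuous_on {0..L+M} k'"
    unfolding cl(3) k'_def
  proof (rule continuous_on_cases)
    show "continuous_on {L..L+M} (\<lambda>t. h' (t - L))"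
      by (rule continuous_on_compose2[OF h(2)]) (auto intro!: continuous_intros)
  qed (use g h L M in \<open>auto simp: le_less\<close>)
  have n: "norm (k' t) = 1" if "t \<in> {0..L+M}" for t
    using that g(3)[of t] h(3)[of "t-L"] unfolding k'_def by auto
  have i1: "((\<lambda>t. k' t \<bullet> \<Phi> (k t)) has_integral I) {0..L}"
    by (rule has_integral_eq[OF _ g(8)]) (auto simp: k_def k'_def)
  have "((\<lambda>t. h' (t - L) \<bullet> \<Phi> (h (t - L))) has_integral J) {L..L+M}"
    using has_integral_affinity[of "\<lambda>t. h' t \<bullet> \<Phi> (h t)" J 0 M 1 "-L"] h(8)
      image_add_atLeastAtMost[of L 0 M]
    by (simp add: add.commute)
  then have i2: "((\<lambda>t. k' t \<bullet> \<Phi> (k t)) has_integral J) {L..L+M}"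
    by (rule has_integral_eq[rotated]) (use g h L M in \<open>auto simp: k_def k'_def dest!: antisym\<close>)
  have i: "((\<lambda>t. k' t \<bullet> \<Phi> (k t)) has_integral (I + J)) {0..L+M}"
    by (rule has_integral_combine[OF _ _ i1 i2]) (use L M in auto)
  have "k 0 = x" "k (L+M) = z" "k' 0 = a" "k' (L+M) = c"
    using L M by (simp_all add: k_def k'_def g(4,6) h(5,7))
  moreover have "0 < L + M" using L M by simp
  ultimately show ?thesis unfolding C1_arc_def using d c n i by blast
qed

lemma C1_arc_integral_le:
  assumes A: "C1_arc \<Phi> x a y b L I" and B: "\<And>z. norm (\<Phi> z) \<le> B"
  shows "\<bar>I\<bar> \<le> B * L"
proof -
  obtain g g' where L: "0 < L" and g:
     "\<forall>t\<in>{0..L}. norm (g' t) = 1"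
     "((\<lambda>t. g' t \<bullet> \<Phi> (g t)) has_integral I) {0..L}"
    using A by (rule C1_arcE) blast
  note g = g[rule_format]
  have B0: "0 \<le> B" using B[of 0] norm_ge_zero order_trans by blast
  have "norm (g' t \<bullet> \<Phi> (g t)) \<le> B" if "t \<in> {0..L}" for t
    using Cauchy_Schwarz_ineq2[of "g' t" "\<Phi> (g t)"] g(1)[OF that] B[of "g t"] by simp
  then have "norm I \<le> B * measure lborel (cbox 0 L)"
    using has_integral_bound[OF B0, of _ I 0 L] g(2) by auto
  then show ?thesis using L by simp
qed

text \<open>A unit-speed curve is the primitive of its direction path. Rescaling \<open>p\<close> to
  time \<open>d\<close> makes the displacement \<open>d\<close> times the mean of \<open>p\<close>,
  so closing up an arc becomes a condition on means alone.\<close>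

lemma C1_arc_of_directions:
  assumes p: "continuous_on {0..1::real} p" "\<And>t. t \<in> {0..1} \<Longrightarrow> norm (p t) = 1"
    and Phi: "continuous_on UNIV \<Phi>" and d: "0 < d"
  shows "\<exists>I. C1_arc \<Phi> x (p 0) (x + d *\<^sub>R integral {0..1} p) (p 1) d I"
proof -
  define g' where "g' t = p (t / d)" for t
  define g where "g t = x + integral {0..t} g'" for t
  have c: "continuous_on {0..d} g'" unfolding g'_def
    by (rule continuous_on_compose2[OF p(1)]) (use d in \<open>auto intro!: continuous_intros\<close>)
  have dg: "(g has_vector_derivative g' t) (at t within {0..d})" if "t \<in> {0..d}" for t
    unfolding g_def[abs_def] using integral_has_vector_derivative[OF c that]
    by (auto intro!: derivative_eq_intros)
  have cg: "continuous_on {0..d} g"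
    using dg has_vector_derivative_continuous continuous_on_eq_continuous_within by blast
  have "(p has_integral integral {0..1} p) (cbox 0 1)"
    using integrable_continuous_real[OF p(1)] by (simp add: has_integral_integral)
  from has_integral_affinity[OF this, of "1/d" 0]
  have "((\<lambda>t. p (t / d)) has_integral d *\<^sub>R integral {0..1} p) ((\<lambda>t. d *\<^sub>R t) ` {0..1})"
    using d by simp
  moreover have "(\<lambda>t. d *\<^sub>R t) ` {0..1} = {0..d}"
    using d by (simp add: image_mult_atLeastAtMost)
  ultimately have "integral {0..d} g' = d *\<^sub>R integral {0..1} p"
    unfolding g'_def by (simp add: integral_unique)
  then have e: "g 0 = x" "g d = x + d *\<^sub>R integral {0..1} p" "g' 0 = p 0" "g' d = p 1"
    using d by (auto simp: g_def g'_def)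
  have "(\<lambda>t. g' t \<bullet> \<Phi> (g t)) integrable_on {0..d}"
    by (intro integrable_continuous_real continuous_on_inner c continuous_on_compose2[OF Phi cg]) auto
  then obtain I where "((\<lambda>t. g' t \<bullet> \<Phi> (g t)) has_integral I) {0..d}" by blast
  moreover have "norm (g' t) = 1" if "t \<in> {0..d}" for t
    unfolding g'_def using that d by (intro p(2)) auto
  ultimately show ?thesis unfolding C1_arc_def using d c dg e
    by (intro exI[of _ I] conjI exI[of _ g] exI[of _ g']) auto
qed

text \<open>Along the straight segment the integrand drops at most \<open>\<eta>\<close> below its
  initial value. The left-endpoint product in the bound is the term that \<open>chain\<close> sums
  up.\<close>

lemma C1_arc_segment:
  assumes Phi: "continuous_on UNIV \<Phi>" and "x \<noteq> y"
    and eta: "\<And>z. dist x z \<le> dist x y \<Longrightarrow> norm (\<Phi> z - \<Phi> x) \<le> \<eta>"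
  shows "\<exists>I. C1_arc \<Phi> x (sgn (y - x)) y (sgn (y - x)) (dist x y) I \<and> \<Phi> x \<bullet> (y - x) - \<eta> * dist x y \<le> I"
proof -
  let ?L = "dist x y" and ?u = "sgn (y - x)"
  have L: "0 < ?L" using assms by simp
  have u: "norm ?u = 1" using assms by (simp add: norm_sgn)
  have Lu: "?L *\<^sub>R ?u = y - x" using assms by (simp add: sgn_div_norm dist_norm norm_minus_commute)
  define g where "g t = x + t *\<^sub>R ?u" for t
  have dg: "(g has_vector_derivative ?u) (at t within S)" for t S
    unfolding g_def by (auto intro!: derivative_eq_intros)
  have "(\<lambda>t. ?u \<bullet> \<Phi> (g t)) integrable_on {0..?L}"
    by (intro integrable_continuous_real continuous_on_inner continuous_on_compose2[OF Phi])
      (auto simp: g_def intro!: continuous_intros)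
  then obtain I where I: "((\<lambda>t. ?u \<bullet> \<Phi> (g t)) has_integral I) {0..?L}" by blast
  have "((\<lambda>t. ?u \<bullet> \<Phi> x - \<eta>) has_integral (?L * (?u \<bullet> \<Phi> x - \<eta>))) {0..?L}"
    using has_integral_const_real[of "?u \<bullet> \<Phi> x - \<eta>" 0 ?L] by simp
  then have "?L * (?u \<bullet> \<Phi> x - \<eta>) \<le> I"
  proof (rule has_integral_le[OF _ I])
    fix t assume t: "t \<in> {0..?L}"
    have "norm (\<Phi> (g t) - \<Phi> x) \<le> \<eta>" using t u by (intro eta) (auto simp: g_def dist_norm)
    then have "\<bar>?u \<bullet> (\<Phi> (g t) - \<Phi> x)\<bar> \<le> \<eta>"
      using Cauchy_Schwarz_ineq2[of ?u "\<Phi> (g t) - \<Phi> x"] u by simp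
    then show "?u \<bullet> \<Phi> x - \<eta> \<le> ?u \<bullet> \<Phi> (g t)" by (simp add: inner_diff_right)
  qed
  moreover have "\<Phi> x \<bullet> (?L *\<^sub>R ?u) = ?L * (?u \<bullet> \<Phi> x)"
    by (simp add: inner_commute)
  then have "?L * (?u \<bullet> \<Phi> x - \<eta>) = \<Phi> x \<bullet> (y - x) - \<eta> * ?L"
    unfolding Lu by (simp add: right_diff_distrib mult.commute)
  moreover have "C1_arc \<Phi> x ?u y ?u ?L I"
    unfolding C1_arc_def using dg u I L Lu
    by (intro conjI exI[of _ g] exI[of _ "\<lambda>_. ?u"]) (auto simp: g_def)
  ultimately show ?thesis by auto
qed

text \<open>Directions \<open>p, r, -p, -r, p\<close> with \<open>p\<close> from \<open>a\<close> to \<open>b\<close> and \<open>r\<close> from \<open>b\<close> to \<open>-a\<close>,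
  where \<open>-p\<close> is traversed at half speed, have zero mean.\<close>
lemma C1_arc_turn:
  fixes a b :: "'a::euclidean_space"
  assumes dim: "DIM('a) \<ge> 2" and Phi: "continuous_on UNIV \<Phi>" and ab: "norm a = 1" "norm b = 1" and d: "0 < d"
  shows "\<exists>I. C1_arc \<Phi> x a x b d I"
proof -
  have P: "\<exists>p. continuous_on {0..1::real} p \<and> (\<forall>t\<in>{0..1}. norm (p t) = 1) \<and> p 0 = u \<and> p 1 = v"
    if "norm u = 1" "norm v = 1" for u v :: 'a
  proof -
    \<comment> \<open>Dimension at least 2 enters here: the unit sphere is path connected.\<close>
    have "u \<in> sphere 0 1" "v \<in> sphere 0 1" using that by auto
    then obtain g where "path g" "path_image g \<subseteq> sphere 0 1" "pathstart g = u" "pathfinish g = v"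
      using path_connected_sphere[OF dim, of 0 1] unfolding path_connected_def by metis
    then show ?thesis
      by (intro exI[of _ g]) (auto simp: path_def path_image_def pathstart_def pathfinish_def)
  qed
  obtain p where p: "continuous_on {0..1::real} p" "\<And>t. t\<in>{0..1} \<Longrightarrow> norm (p t) = 1" "p 0 = a" "p 1 = b"
    using P[OF ab] by blast
  obtain r where r: "continuous_on {0..1::real} r" "\<And>t. t\<in>{0..1} \<Longrightarrow> norm (r t) = 1" "r 0 = b" "r 1 = -a"
    using P[of b "-a"] ab by auto
  define m q where "m = integral {0..1} p" and "q = integral {0..1} r"
  note D = C1_arc_of_directions[OF _ _ Phi]
  have A1: "\<exists>I. C1_arc \<Phi> x a (x + c *\<^sub>R m) b c I" if "0 < c" for x c
    using D[OF p(1,2) that, of x] p by (simp add: m_def)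
  have A2: "\<exists>I. C1_arc \<Phi> x b (x + c *\<^sub>R q) (-a) c I" if "0 < c" for x c
    using D[OF r(1,2) that, of x] r by (simp add: q_def)
  have A3: "\<exists>I. C1_arc \<Phi> x (-a) (x - c *\<^sub>R m) (-b) c I" if "0 < c" for x c
    using D[of "\<lambda>t. - p t" c x] that p by (simp add: m_def continuous_on_minus)
  have A4: "\<exists>I. C1_arc \<Phi> x (-b) (x - c *\<^sub>R q) a c I" if "0 < c" for x c
    using D[of "\<lambda>t. - r t" c x] that r by (simp add: q_def continuous_on_minus)
  \<comment> \<open>The five pieces last \<open>c\<close>, \<open>c\<close>, \<open>2 * c\<close>,
    \<open>c\<close>, \<open>c\<close>, six units in all. After \<open>-r\<close> the direction is
    \<open>a\<close> again, so a second copy of \<open>p\<close> is needed to reach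
    \<open>b\<close>; the doubled \<open>-p\<close> cancels both copies.\<close>
  define c where "c = d / 6"
  have c: "0 < c" "0 < 2 * c" "c + c + 2*c + c + c = d" using d by (auto simp: c_def)
  obtain I1 where 1: "C1_arc \<Phi> x a (x + c *\<^sub>R m) b c I1" using A1 c by blast
  obtain I2 where 2: "C1_arc \<Phi> (x + c *\<^sub>R m) b (x + c *\<^sub>R m + c *\<^sub>R q) (-a) c I2" using A2 c by blast
  obtain I3 where "C1_arc \<Phi> (x + c *\<^sub>R m + c *\<^sub>R q) (-a) (x + c *\<^sub>R m + c *\<^sub>R q - (2*c) *\<^sub>R m) (-b) (2*c) I3"
    using A3 c by blast
  moreover have "x + c *\<^sub>R m + c *\<^sub>R q - (2*c) *\<^sub>R m = x - c *\<^sub>R m + c *\<^sub>R q"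
    by (simp add: algebra_simps flip: scaleR_2)
  ultimately have 3: "C1_arc \<Phi> (x + c *\<^sub>R m + c *\<^sub>R q) (-a) (x - c *\<^sub>R m + c *\<^sub>R q) (-b) (2*c) I3" by simp
  obtain I4 where 4: "C1_arc \<Phi> (x - c *\<^sub>R m + c *\<^sub>R q) (-b) (x - c *\<^sub>R m) a c I4"
    using A4[OF c(1), of "x - c *\<^sub>R m + c *\<^sub>R q"] by auto
  obtain I5 where 5: "C1_arc \<Phi> (x - c *\<^sub>R m) a x b c I5"
    using A1[OF c(1), of "x - c *\<^sub>R m"] by auto
  show ?thesis
    using C1_arc_join[OF C1_arc_join[OF C1_arc_join[OF C1_arc_join[OF 1 2] 3] 4] 5] c(3) by auto
qed

text \<open>All edges start and end with the same auxiliary direction \<open>a\<close>, so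
  consecutive edges fit \<open>C1_arc_join\<close> whatever their slopes. The price is a turn of
  length \<open>\<tau>\<close> at each end, which changes the integral by at most
  \<open>B * \<tau>\<close>.\<close>

lemma C1_arc_edge:
  fixes a x y :: "'a::euclidean_space"
  assumes dim: "DIM('a) \<ge> 2" and Phi: "continuous_on UNIV \<Phi>" and B: "\<And>z. norm (\<Phi> z) \<le> B"
    and a: "norm a = 1" and "x \<noteq> y" and \<tau>: "0 < \<tau>"
    and eta: "\<And>z. dist x z \<le> dist x y \<Longrightarrow> norm (\<Phi> z - \<Phi> x) \<le> \<eta>"
  shows "\<exists>I. C1_arc \<Phi> x a y a (dist x y + 2 * \<tau>) I \<and> \<Phi> x \<bullet> (y - x) - \<eta> * dist x y - 2 * B * \<tau> \<le> I"
proof -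
  let ?u = "sgn (y - x)"
  have u: "norm ?u = 1" using assms by (simp add: norm_sgn)
  obtain I where I: "C1_arc \<Phi> x ?u y ?u (dist x y) I" "\<Phi> x \<bullet> (y - x) - \<eta> * dist x y \<le> I"
    using C1_arc_segment[OF Phi \<open>x \<noteq> y\<close> eta] by blast
  obtain J where J: "C1_arc \<Phi> x a x ?u \<tau> J" using C1_arc_turn[OF dim Phi a u \<tau>] by blast
  obtain K where K: "C1_arc \<Phi> y ?u y a \<tau> K" using C1_arc_turn[OF dim Phi u a \<tau>] by blast
  have "\<bar>J\<bar> \<le> B * \<tau>" "\<bar>K\<bar> \<le> B * \<tau>" using J K C1_arc_integral_le B by blast+
  moreover have "\<tau> + dist x y + \<tau> = dist x y + 2 * \<tau>" by simp
  ultimately show ?thesis using C1_arc_join[OF C1_arc_join[OF J I(1)] K] I(2)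
    by (intro exI[of _ "J + I + K"]) (auto simp: algebra_simps)
qed

lemma C1_arc_repeat:
  assumes "C1_arc \<Phi> x a x a L I"
  shows "C1_arc \<Phi> x a x a (real (Suc k) * L) (real (Suc k) * I)"
proof (induction k)
  case (Suc k)
  show ?case using C1_arc_join[OF Suc assms] by (simp add: algebra_simps)
qed (use assms in simp)

lemma C1_arc_closed:
  assumes "C1_arc \<Phi> x a x a L I"
  shows "\<exists>\<gamma>. arclength_C1_closed_curve \<gamma> L \<and> curve_measure \<gamma> L \<Phi> = I"
proof -
  obtain g g' where L: "0 < L" and g: "\<forall>t\<in>{0..L}. (g has_vector_derivative g' t) (at t within {0..L})"
    "continuous_on {0..L} g'" "\<forall>t\<in>{0..L}. norm (g' t) = 1"
    "g 0 = x" "g L = x" "g' 0 = a" "g' L = a" "((\<lambda>t. g' t \<bullet> \<Phi> (g t)) has_integral I) {0..L}"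
    using assms by (rule C1_arcE)
  note g = g[rule_format]
  have "((\<lambda>t. vector_derivative g (at t within {0..L}) \<bullet> \<Phi> (g t)) has_integral I) {0..L}"
    by (rule has_integral_eq[OF _ g(8)]) (metis g(1) vector_derivative_within_closed_interval[OF L])
  then have "curve_measure g L \<Phi> = I" by (simp add: curve_measure_def integral_unique)
  moreover have "arclength_C1_closed_curve g L"
    unfolding arclength_C1_closed_curve_def
    by (intro conjI exI[of _ g'] ballI) (use L g in auto)
  ultimately show ?thesis by blast
qed

section \<open>Closed curves as bounded linear functionals on fields\<close>

lemma curve_measure_integrable:
  assumes "arclength_C1_closed_curve \<gamma> L" "continuous_on UNIV \<Phi>"
  shows "(\<lambda>t. vector_derivative \<gamma> (at t within {0..L}) \<bullet> \<Phi> (\<gamma> t)) integrable_on {0..L}"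
proof -
  obtain g' where L: "0 < L" and g: "\<forall>t\<in>{0..L}. (\<gamma> has_vector_derivative g' t) (at t within {0..L})"
    "continuous_on {0..L} g'"
    using assms(1) by (rule closed_curveE) blast
  note g = g[rule_format]
  have cg: "continuous_on {0..L} \<gamma>"
    using g(1) has_vector_derivative_continuous continuous_on_eq_continuous_within by blast
  have "(\<lambda>t. g' t \<bullet> \<Phi> (\<gamma> t)) integrable_on {0..L}"
    by (intro integrable_continuous_real continuous_on_inner g continuous_on_compose2[OF assms(2) cg]) auto
  then show ?thesis
    by (rule integrable_eq) (metis g(1) vector_derivative_within_closed_interval[OF L])
qed

lemma curve_measure_add:
  assumes "arclength_C1_closed_curve \<gamma> L" "continuous_on UNIV \<Phi>" "continuous_on UNIV \<Psi>"
  shows "curve_measure \<gamma> L (\<lambda>x. \<Phi> x + \<Psi> x) = curve_measure \<gamma> L \<Phi> + curve_measure \<gamma> L \<Psi>"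
  unfolding curve_measure_def inner_add_right
  by (intro integral_add curve_measure_integrable assms)

lemma curve_measure_scaleR:
  "curve_measure \<gamma> L (\<lambda>x. c *\<^sub>R \<Phi> x) = c * curve_measure \<gamma> L \<Phi>"
  unfolding curve_measure_def by simp

lemma curve_measure_bound:
  assumes "arclength_C1_closed_curve \<gamma> L" "continuous_on UNIV \<Phi>" "\<And>x. norm (\<Phi> x) \<le> B"
  shows "\<bar>curve_measure \<gamma> L \<Phi>\<bar> \<le> B * L"
proof -
  obtain g' where L: "0 < L" and g: "\<forall>t\<in>{0..L}. (\<gamma> has_vector_derivative g' t) (at t within {0..L})"
    "\<forall>t\<in>{0..L}. norm (g' t) = 1"
    using assms(1) by (rule closed_curveE) blast
  note g = g[rule_format]
  have "norm (vector_derivative \<gamma> (at t within {0..L}) \<bullet> \<Phi> (\<gamma> t)) \<le> B" if "t \<in> {0..L}" for t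
    using Cauchy_Schwarz_ineq2[of "g' t" "\<Phi> (\<gamma> t)"] g(2)[OF that] assms(3)[of "\<gamma> t"]
      vector_derivative_within_closed_interval[OF L that g(1)[OF that]] by simp
  moreover have "0 \<le> B" using assms(3)[of 0] norm_ge_zero order_trans by blast
  ultimately show ?thesis
    using has_integral_bound[OF _ _, of B "\<lambda>t. vector_derivative \<gamma> (at t within {0..L}) \<bullet> \<Phi> (\<gamma> t)" _ 0 L]
      integrable_integral[OF curve_measure_integrable[OF assms(1,2)]] L
    by (auto simp: curve_measure_def)
qed

subsection \<open>Smooth kernels and mollification\<close>

text \<open>The flat function \<open>exp (- 1 / t)\<close> together with its quotients by powers of
  \<open>t\<close>: differentiation raises the power, so the whole family is needed to stay closed
  under it.\<close>

definition expinv :: "nat \<Rightarrow> real \<Rightarrow> real" where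
  "expinv k t = (if t \<le> 0 then 0 else exp (- 1 / t) / t ^ k)"

lemma power_div_fact_le_exp:
  fixes x :: real
  assumes "0 \<le> x"
  shows "x ^ n / fact n \<le> exp x"
proof -
  have "(\<lambda>n. x ^ n /\<^sub>R fact n) sums exp x" by (rule exp_converges)
  then have "(\<Sum>n\<in>{n}. x ^ n /\<^sub>R fact n) \<le> exp x"
    by (intro sum_le_suminf[THEN order_trans]) (use assms in \<open>auto simp: sums_iff\<close>)
  then show ?thesis by (simp add: divide_inverse mult.commute)
qed

text \<open>A single term of the exponential series at \<open>1 / t\<close>, of order
  \<open>k + 1\<close>, beats the denominator and leaves one spare factor \<open>t\<close>. That
  factor gives the derivative at 0.\<close>

lemma expinv_bound: "\<bar>expinv k t\<bar> \<le> fact (k + 1) * \<bar>t\<bar>"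
proof (cases "t \<le> 0")
  case False
  then have t: "0 < t" by simp
  define n where "n = k + 1"
  have "(1 / t) ^ n / fact n \<le> exp (1 / t)"
    using t by (intro power_div_fact_le_exp) auto
  then have "(1 / t) ^ n \<le> fact n * exp (1 / t)"
    by (simp add: pos_divide_le_eq mult.commute)
  then have "exp (- 1 / t) * (1 / t) ^ n \<le> exp (- 1 / t) * (fact n * exp (1 / t))"
    by (intro mult_left_mono) auto
  also have "\<dots> = fact n" by (simp add: exp_minus)
  finally have "exp (- 1 / t) * (1 / t) ^ (k + 1) \<le> fact (k + 1)" by (simp only: n_def)
  then have "exp (- 1 / t) / t ^ k \<le> fact (k + 1) * t"
    using t by (simp add: power_one_over divide_simps mult_ac)
  then show ?thesis using t by (simp add: expinv_def)
next
  case True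
  have "0 \<le> fact (k + 1) * \<bar>t\<bar>" by (intro mult_nonneg_nonneg fact_ge_zero abs_ge_zero)
  moreover have "expinv k t = 0" using True by (simp add: expinv_def)
  ultimately show ?thesis by (simp only: abs_zero)
qed

lemma expinv_has_real_derivative:
  "(expinv k has_real_derivative expinv (k + 2) t - real k * expinv (k + 1) t) (at t)"
proof (rule linorder_cases[of t 0])
  assume t: "t < 0"
  have "((\<lambda>_. 0) has_real_derivative 0) (at t)" by simp
  then have "(expinv k has_real_derivative 0) (at t)"
    by (rule has_field_derivative_transform_within[where d="-t"]) (use t in \<open>auto simp: expinv_def dist_real_def\<close>)
  then show ?thesis using t by (simp add: expinv_def)
next
  assume t: "t = 0"
  have "((\<lambda>h. expinv k h / h) \<longlongrightarrow> 0) (at 0)"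
  proof (rule Lim_null_comparison)
    show "\<forall>\<^sub>F h in at 0. norm (expinv k h / h) \<le> fact (k + 2) * \<bar>h\<bar>"
    proof (rule eventuallyI)
      \<comment> \<open>For positive \<open>h\<close>, division by \<open>h\<close> turns
        \<open>expinv k\<close> into \<open>expinv (k + 1)\<close>, so the difference quotient obeys
        the bound of the next index.\<close>
      fix h show "norm (expinv k h / h) \<le> fact (k + 2) * \<bar>h\<bar>"
        using expinv_bound[of "k + 1" h] by (auto simp: expinv_def mult.commute)
    qed
    show "((\<lambda>h. fact (k + 2) * \<bar>h\<bar>) \<longlongrightarrow> (0::real)) (at 0)"
      by (auto intro!: tendsto_eq_intros)
  qed
  moreover have "expinv j 0 = 0" for j by (simp add: expinv_def)
  ultimately show ?thesis using t by (simp add: DERIV_def)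
next
  assume t: "0 < t"
  have "((\<lambda>t. exp (- 1 / t) / t ^ k) has_real_derivative
        (exp (- 1 / t) * (1 / t^2) * t ^ k - exp (- 1 / t) * (real k * t ^ (k - 1))) / (t ^ k * t ^ k)) (at t)"
    using t by (auto intro!: derivative_eq_intros simp: power2_eq_square)
  also have "(exp (- 1 / t) * (1 / t^2) * t ^ k - exp (- 1 / t) * (real k * t ^ (k - 1))) / (t ^ k * t ^ k)
     = expinv (k + 2) t - real k * expinv (k + 1) t"
    using t by (cases k) (auto simp: expinv_def field_simps power2_eq_square)
  finally show ?thesis
    by (rule has_field_derivative_transform_within[where d=t]) (use t in \<open>auto simp: expinv_def dist_real_def\<close>)
qed

text \<open>An algebra of functions closed under directional derivatives, so that all its members are
  smooth in the sense of iterated derivatives.\<close>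
inductive_set bump_alg :: "real \<Rightarrow> ('a::euclidean_space \<Rightarrow> real) set" for r where
  const: "(\<lambda>x. c) \<in> bump_alg r"
| inner: "(\<lambda>x. x \<bullet> b) \<in> bump_alg r"
| bump: "(\<lambda>x. expinv k (r - x \<bullet> x)) \<in> bump_alg r"
| add: "f \<in> bump_alg r \<Longrightarrow> g \<in> bump_alg r \<Longrightarrow> (\<lambda>x. f x + g x) \<in> bump_alg r"
| mult: "f \<in> bump_alg r \<Longrightarrow> g \<in> bump_alg r \<Longrightarrow> (\<lambda>x. f x * g x) \<in> bump_alg r"

lemma bump_alg_derivative:
  assumes "f \<in> bump_alg r"
  shows "\<exists>D. (\<forall>x. (f has_derivative D x) (at x)) \<and> (\<forall>v. (\<lambda>x. D x v) \<in> bump_alg r)"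
  using assms
proof induction
  case (const c)
  show ?case by (rule exI[of _ "\<lambda>x v. 0"]) (auto intro: bump_alg.intros)
next
  case (inner b)
  show ?case
    by (rule exI[of _ "\<lambda>x v. v \<bullet> b"]) (auto intro!: bump_alg.intros derivative_eq_intros)
next
  case (bump k)
  \<comment> \<open>The minus sign is written as a product with the constant
    \<open>- real k\<close>, since the algebra is generated by sums and products only.\<close>
  let ?D = "\<lambda>x v. (expinv (k + 2) (r - x \<bullet> x) + (- real k) * expinv (k + 1) (r - x \<bullet> x)) * ((-2) * (x \<bullet> v))"
  have "((\<lambda>x. expinv k (r - x \<bullet> x)) has_derivative ?D x) (at x)" for x :: 'a
  proof -
    have 1: "((\<lambda>x. r - x \<bullet> x) has_derivative (\<lambda>v. (-2) * (x \<bullet> v))) (at x)"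
      by (auto intro!: derivative_eq_intros simp: inner_commute)
    have "((\<lambda>x. expinv k (r - x \<bullet> x)) has_derivative
        (\<lambda>v. (expinv (k + 2) (r - x \<bullet> x) - real k * expinv (k + 1) (r - x \<bullet> x)) * ((-2) * (x \<bullet> v)))) (at x)"
      using has_derivative_compose[OF 1 expinv_has_real_derivative[unfolded has_field_derivative_def]] .
    then show ?thesis by simp
  qed
  moreover have "(\<lambda>x. ?D x v) \<in> bump_alg r" for v
    by (intro bump_alg.intros)
  ultimately show ?case by (intro exI[of _ ?D]) auto
next
  case (add f g)
  then obtain D E where "\<forall>x. (f has_derivative D x) (at x)" "\<forall>v. (\<lambda>x. D x v) \<in> bump_alg r"
    "\<forall>x. (g has_derivative E x) (at x)" "\<forall>v. (\<lambda>x. E x v) \<in> bump_alg r" by blast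
  then show ?case
    by (intro exI[of _ "\<lambda>x v. D x v + E x v"]) (auto intro!: bump_alg.intros has_derivative_add)
next
  case (mult f g)
  then obtain D E where "\<forall>x. (f has_derivative D x) (at x)" "\<forall>v. (\<lambda>x. D x v) \<in> bump_alg r"
    "\<forall>x. (g has_derivative E x) (at x)" "\<forall>v. (\<lambda>x. E x v) \<in> bump_alg r" by blast
  then show ?case using mult
    by (intro exI[of _ "\<lambda>x v. f x * E x v + D x v * g x"]) (auto intro!: bump_alg.intros has_derivative_mult)
qed

lemma iter_dderiv_bump_alg: "f \<in> bump_alg r \<Longrightarrow> iter_dderiv f vs \<in> bump_alg r"
proof (induction vs)
  case (Cons v vs)
  then obtain D where D: "\<forall>x. (iter_dderiv f vs has_derivative D x) (at x)" "\<forall>v. (\<lambda>x. D x v) \<in> bump_alg r"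
    using bump_alg_derivative by blast
  then have "frechet_derivative (iter_dderiv f vs) (at x) = D x" for x
    using frechet_derivative_at by metis
  then show ?case using D by simp
qed simp

lemma smooth_fun_bump_alg: "f \<in> bump_alg r \<Longrightarrow> smooth_fun f"
  unfolding smooth_fun_def differentiable_def
  using iter_dderiv_bump_alg bump_alg_derivative by blast

lemma smooth_fun_iter_dderiv_continuous:
  assumes "smooth_fun f" "set vs \<subseteq> Basis"
  shows "continuous_on S (iter_dderiv f vs)"
  using assms unfolding smooth_fun_def
  by (meson continuous_at_imp_continuous_on differentiable_imp_continuous_within)

text \<open>The shift falls on the kernel \<open>\<rho>\<close> and the domain is a fixed box, so
  derivatives hit only \<open>\<rho>\<close> and continuity of \<open>\<psi>\<close>
  suffices.\<close>

definition convolve :: "'a set \<Rightarrow> ('a::euclidean_space \<Rightarrow> real) \<Rightarrow> ('a \<Rightarrow> real) \<Rightarrow> 'a \<Rightarrow> real" where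
  "convolve S \<psi> \<rho> x = integral S (\<lambda>t. \<psi> t * \<rho> (x - t))"

lemma convolve_has_derivative:
  fixes \<psi> \<rho> :: "'a::euclidean_space \<Rightarrow> real"
  assumes psi: "continuous_on (cbox a b) \<psi>"
    and D: "\<And>x. (\<rho> has_derivative D x) (at x)"
    and cD: "\<And>i. i \<in> Basis \<Longrightarrow> continuous_on UNIV (\<lambda>x. D x i)"
  shows "(convolve (cbox a b) \<psi> \<rho> has_derivative
     (\<lambda>v. \<Sum>i\<in>Basis. (v \<bullet> i) * convolve (cbox a b) \<psi> (\<lambda>z. D z i) x)) (at x)"
proof -
  \<comment> \<open>The Leibniz rule wants a jointly continuous field of bounded linear maps.
    Continuity of \<open>D\<close> is assumed only in basis directions, so the map is assembled from
    coordinate functionals.\<close>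
  let ?fx = "\<lambda>x t. \<Sum>i\<in>Basis. (\<psi> t * D (x - t) i) *\<^sub>R blinfun_inner_left i"
  have Dlin: "D x v = (\<Sum>i\<in>Basis. (v \<bullet> i) * D x i)" for x v
  proof -
    interpret linear "D x" using has_derivative_linear[OF D] .
    have "D x v = D x (\<Sum>i\<in>Basis. (v \<bullet> i) *\<^sub>R i)" by (simp add: euclidean_representation)
    then show ?thesis by (simp add: sum scale)
  qed
  have crho: "continuous_on UNIV \<rho>"
    using D has_derivative_continuous continuous_at_imp_continuous_on by blast
  have ap: "blinfun_apply (?fx x t) v = \<psi> t * D (x - t) v" for x t v
    by (simp add: blinfun.sum_left blinfun.scaleR_left Dlin[of _ v] sum_distrib_left inner_commute
         mult_ac)
  have cont: "continuous_on (UNIV \<times> cbox a b) (\<lambda>(x, t). ?fx x t)"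
    unfolding split_beta
    by (intro continuous_intros continuous_on_compose2[OF psi] continuous_on_compose2[OF cD]) auto
  have "((\<lambda>x. integral (cbox a b) (\<lambda>t. \<psi> t * \<rho> (x - t))) has_derivative
       blinfun_apply (integral (cbox a b) (?fx x))) (at x within UNIV)"
  proof (rule leibniz_rule[OF _ _ cont])
    fix x t :: 'a
    have 1: "((\<lambda>x. x - t) has_derivative (\<lambda>v. v)) (at x)" by (auto intro!: derivative_eq_intros)
    have "((\<lambda>x. \<rho> (x - t)) has_derivative (\<lambda>v. D (x - t) v)) (at x)"
      using has_derivative_compose[OF 1 D] .
    then have "((\<lambda>x. \<psi> t * \<rho> (x - t)) has_derivative (\<lambda>v. \<psi> t * D (x - t) v)) (at x)"
      by (rule has_derivative_mult_right)
    moreover have "(\<lambda>v. \<psi> t * D (x - t) v) = blinfun_apply (?fx x t)" using ap by auto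
    ultimately show "((\<lambda>x. \<psi> t * \<rho> (x - t)) has_derivative blinfun_apply (?fx x t)) (at x within UNIV)"
      by simp
  next
    fix x :: 'a show "(\<lambda>t. \<psi> t * \<rho> (x - t)) integrable_on cbox a b"
      by (intro integrable_continuous continuous_intros psi continuous_on_compose2[OF crho]) auto
  qed auto
  moreover have "blinfun_apply (integral (cbox a b) (?fx x)) =
      (\<lambda>v. \<Sum>i\<in>Basis. (v \<bullet> i) * convolve (cbox a b) \<psi> (\<lambda>z. D z i) x)"
  proof
    fix v
    have i1: "?fx x integrable_on cbox a b"
      by (intro integrable_continuous continuous_intros psi continuous_on_compose2[OF cD]) auto
    have i2: "(\<lambda>t. \<psi> t * D (x - t) i) integrable_on cbox a b" if "i \<in> Basis" for i
      by (intro integrable_continuous continuous_intros psi continuous_on_compose2[OF cD[OF that]]) auto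
    have "blinfun_apply (integral (cbox a b) (?fx x)) v = integral (cbox a b) (\<lambda>t. blinfun_apply (?fx x t) v)"
      using blinfun_apply_integral[OF i1] by simp
    also have "\<dots> = integral (cbox a b) (\<lambda>t. \<Sum>i\<in>Basis. (v \<bullet> i) * (\<psi> t * D (x - t) i))"
      unfolding ap by (subst Dlin) (simp add: sum_distrib_left mult_ac)
    also have "\<dots> = (\<Sum>i\<in>Basis. (v \<bullet> i) * integral (cbox a b) (\<lambda>t. \<psi> t * D (x - t) i))"
      using i2 by (subst integral_sum) (auto intro!: integrable_on_mult_right)
    finally show "blinfun_apply (integral (cbox a b) (?fx x)) v
       = (\<Sum>i\<in>Basis. (v \<bullet> i) * convolve (cbox a b) \<psi> (\<lambda>z. D z i) x)"
      by (simp add: convolve_def)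
  qed
  ultimately show ?thesis unfolding convolve_def[abs_def] by simp
qed

lemma convolve_iter_dderiv_has_derivative:
  fixes \<psi> \<rho> :: "'a::euclidean_space \<Rightarrow> real"
  assumes psi: "continuous_on (cbox a b) \<psi>" and rho: "smooth_fun \<rho>" and vs: "set vs \<subseteq> Basis"
  shows "(convolve (cbox a b) \<psi> (iter_dderiv \<rho> vs) has_derivative
     (\<lambda>v. \<Sum>i\<in>Basis. (v \<bullet> i) * convolve (cbox a b) \<psi> (iter_dderiv \<rho> (i # vs)) x)) (at x)"
proof -
  have "(iter_dderiv \<rho> vs has_derivative frechet_derivative (iter_dderiv \<rho> vs) (at x)) (at x)" for x
    using rho vs unfolding smooth_fun_def frechet_derivative_works by blast
  moreover have "continuous_on UNIV (\<lambda>x. frechet_derivative (iter_dderiv \<rho> vs) (at x) i)" if "i \<in> Basis" for i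
    using smooth_fun_iter_dderiv_continuous[OF rho, of "i # vs"] vs that by simp
  ultimately show ?thesis
    using convolve_has_derivative[OF psi, of "iter_dderiv \<rho> vs" "\<lambda>x. frechet_derivative (iter_dderiv \<rho> vs) (at x)"]
    by simp
qed

text \<open>In a basis direction the coordinate sum of the derivative collapses to one term, so by
  induction every iterated derivative moves onto the kernel.\<close>

lemma iter_dderiv_convolve:
  fixes \<psi> \<rho> :: "'a::euclidean_space \<Rightarrow> real"
  assumes psi: "continuous_on (cbox a b) \<psi>" and rho: "smooth_fun \<rho>" and "set vs \<subseteq> Basis"
  shows "iter_dderiv (convolve (cbox a b) \<psi> \<rho>) vs = convolve (cbox a b) \<psi> (iter_dderiv \<rho> vs)"
  using \<open>set vs \<subseteq> Basis\<close>
proof (induction vs)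
  case (Cons v vs)
  then have v: "v \<in> Basis" and vs: "set vs \<subseteq> Basis" by auto
  note d = convolve_iter_dderiv_has_derivative[OF psi rho vs]
  have "iter_dderiv (convolve (cbox a b) \<psi> \<rho>) (v # vs) x
      = (\<Sum>i\<in>Basis. (v \<bullet> i) * convolve (cbox a b) \<psi> (iter_dderiv \<rho> (i # vs)) x)" for x
    by (simp add: Cons.IH[OF vs] frechet_derivative_at[OF d, symmetric])
  also have "\<dots> x = convolve (cbox a b) \<psi> (iter_dderiv \<rho> (v # vs)) x" for x
    using v by (simp add: inner_Basis if_distrib[of "\<lambda>u. u * _"] cong: if_cong)
  finally show ?case by blast
qed simp

lemma smooth_fun_convolve:
  fixes \<psi> \<rho> :: "'a::euclidean_space \<Rightarrow> real"
  assumes "continuous_on (cbox a b) \<psi>" and "smooth_fun \<rho>"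
  shows "smooth_fun (convolve (cbox a b) \<psi> \<rho>)"
  unfolding smooth_fun_def
proof (intro allI impI)
  fix vs :: "'a list" and x :: 'a
  assume vs: "set vs \<subseteq> Basis"
  show "iter_dderiv (convolve (cbox a b) \<psi> \<rho>) vs differentiable (at x)"
    unfolding iter_dderiv_convolve[OF assms vs] differentiable_def
    by (rule exI, rule convolve_iter_dderiv_has_derivative[OF assms vs])
qed

section \<open>Gradients of test functions and their distance to a field\<close>

lemma grad_inner:
  assumes "f differentiable (at x)"
  shows "grad f x \<bullet> v = frechet_derivative f (at x) v"
proof -
  interpret linear "frechet_derivative f (at x)" using assms by (rule linear_frechet_derivative)
  have "frechet_derivative f (at x) v = frechet_derivative f (at x) (\<Sum>i\<in>Basis. (v \<bullet> i) *\<^sub>R i)"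
    by (simp add: euclidean_representation)
  then show ?thesis by (simp add: sum scale grad_def inner_sum_left) (simp add: inner_commute mult.commute)
qed

text \<open>\<open>F\<close> is additive on \<open>C0_fields\<close> only, so gradients must be
  placed there before they can be split off from a field.\<close>

lemma grad_test_fun_C0:
  assumes "test_fun g"
  shows "grad g \<in> C0_fields"
proof -
  have sm: "smooth_fun g" and K: "compact (closure {x. g x \<noteq> 0})" using assms by (auto simp: test_fun_def)
  have "continuous_on UNIV (\<lambda>x. frechet_derivative g (at x) b)" if "b \<in> Basis" for b
    using smooth_fun_iter_dderiv_continuous[OF sm, of "[b]"] that by simp
  then have "continuous_on UNIV (grad g)"
    unfolding grad_def[abs_def] by (intro continuous_intros)
  moreover have z: "grad g x = 0" if "x \<notin> closure {x. g x \<noteq> 0}" for x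
  proof -
    have "(g has_derivative (\<lambda>_. 0)) (at x)"
    proof (rule has_derivative_transform_within_open[OF has_derivative_const[of 0]])
      show "open (- closure {x. g x \<noteq> 0})" by (simp add: open_Compl)
      show "x \<in> - closure {x. g x \<noteq> 0}" using that by simp
      fix y assume y: "y \<in> - closure {x. g x \<noteq> 0}"
      show "0 = g y"
      proof (rule ccontr)
        assume "0 \<noteq> g y"
        then have "y \<in> {x. g x \<noteq> 0}" by simp
        then have "y \<in> closure {x. g x \<noteq> 0}" using closure_subset by (rule subsetD[rotated])
        then show False using y by simp
      qed
    qed
    note frechet_derivative_at[OF this, symmetric]
    then show ?thesis by (simp add: grad_def)
  qed
  have "bounded (closure {x. g x \<noteq> 0})" using K by (rule compact_imp_bounded)
  then obtain R where R: "\<forall>x\<in>closure {x. g x \<noteq> 0}. norm x \<le> R"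
    unfolding bounded_iff by (elim exE)
  then have "\<forall>\<^sub>F x in at_infinity. grad g x = 0"
    unfolding eventually_at_infinity
  proof (intro exI[of _ "R + 1"] allI impI)
    fix x :: 'a assume "R + 1 \<le> norm x"
    show "grad g x = 0"
    proof (rule z)
      show "x \<notin> closure {x. g x \<noteq> 0}"
      proof
        assume "x \<in> closure {x. g x \<noteq> 0}"
        then have "norm x \<le> R" using R by (rule bspec[rotated])
        then show False using \<open>R + 1 \<le> norm x\<close> by linarith
      qed
    qed
  qed
  then have "(grad g \<longlongrightarrow> 0) at_infinity" by (simp add: tendsto_eventually)
  ultimately show ?thesis by (simp add: C0_fields_def)
qed

text \<open>Reflection \<open>t \<mapsto> x - t\<close>. With the shift on the kernel the
  convolution can be differentiated; with the shift on \<open>\<psi>\<close> an increment estimate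
  for \<open>\<psi>\<close> can be averaged.\<close>

lemma convolve_commute:
  fixes \<psi> \<rho> :: "'a::euclidean_space \<Rightarrow> real"
  assumes psi: "continuous_on UNIV \<psi>" "\<And>t. t \<notin> cbox a b \<Longrightarrow> \<psi> t = 0"
    and rho: "continuous_on UNIV \<rho>" "\<And>t. t \<notin> cbox c d \<Longrightarrow> \<rho> t = 0"
  shows "convolve (cbox a b) \<psi> \<rho> x = integral (cbox c d) (\<lambda>z. \<psi> (x - z) * \<rho> z)"
proof -
  define I where "I = convolve (cbox a b) \<psi> \<rho> x"
  have "(\<lambda>t. \<psi> t * \<rho> (x - t)) integrable_on cbox a b"
    by (intro integrable_continuous continuous_intros continuous_on_compose2[OF psi(1)]
        continuous_on_compose2[OF rho(1)]) auto
  then have "((\<lambda>t. \<psi> t * \<rho> (x - t)) has_integral I) (cbox a b)"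
    unfolding I_def convolve_def by (rule integrable_integral)
  from has_integral_affinity[OF this, of "-1" x]
  have "((\<lambda>z. \<psi> (x - z) * \<rho> z) has_integral I) ((\<lambda>t. x - t) ` cbox a b)" by simp
  then have "((\<lambda>z. \<psi> (x - z) * \<rho> z) has_integral I) UNIV"
  proof (rule has_integral_on_superset)
    fix z assume "z \<notin> (\<lambda>t. x - t) ` cbox a b"
    then have "x - z \<notin> cbox a b" by (metis diff_diff_eq2 add_diff_cancel_left' imageI)
    then show "\<psi> (x - z) * \<rho> z = 0" using psi(2) by simp
  qed simp
  moreover have "(\<lambda>z. if z \<in> cbox c d then \<psi> (x - z) * \<rho> z else 0) = (\<lambda>z. \<psi> (x - z) * \<rho> z)"
    using rho(2) by (auto simp: fun_eq_iff)
  ultimately have "((\<lambda>z. \<psi> (x - z) * \<rho> z) has_integral I) (cbox c d)"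
    using has_integral_restrict_UNIV[of "cbox c d" "\<lambda>z. \<psi> (x - z) * \<rho> z" I] by simp
  then show ?thesis unfolding I_def by (rule integral_unique[symmetric])
qed

lemma smooth_kernel:
  fixes r :: real
  assumes r: "0 < r" and sub: "ball (0::'a::euclidean_space) r \<subseteq> cbox a b"
  shows "\<exists>\<rho>::'a \<Rightarrow> real. smooth_fun \<rho> \<and> (\<forall>z. 0 \<le> \<rho> z) \<and> (\<forall>z. r \<le> norm z \<longrightarrow> \<rho> z = 0)
     \<and> integral (cbox a b) \<rho> = 1"
proof -
  define \<rho> :: "'a \<Rightarrow> real" where "\<rho> z = expinv 0 (r\<^sup>2 - z \<bullet> z)" for z
  have alg: "\<rho> \<in> bump_alg (r\<^sup>2)" unfolding \<rho>_def[abs_def] by (rule bump_alg.bump)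
  have cont: "continuous_on UNIV \<rho>"
    using smooth_fun_iter_dderiv_continuous[OF smooth_fun_bump_alg[OF alg], of "[]"] by simp
  have nn: "0 \<le> \<rho> z" for z by (simp add: \<rho>_def expinv_def)
  have z: "\<rho> z = 0" if "r \<le> norm z" for z
  proof -
    have "r\<^sup>2 \<le> (norm z)\<^sup>2" using that r by (intro power_mono) auto
    then show ?thesis by (simp add: \<rho>_def expinv_def power2_norm_eq_inner)
  qed
  have p: "0 < \<rho> 0" using r by (simp add: \<rho>_def expinv_def)
  define c where "c = integral (cbox a b) \<rho>"
  have int: "\<rho> integrable_on cbox a b"
    using cont continuous_on_subset by (intro integrable_continuous) blast
  have "0 \<le> c" unfolding c_def using int nn by (intro integral_nonneg) auto
  \<comment> \<open>A continuous nonnegative function with zero integral vanishes on the box, but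
    the bump is positive at 0, which is an interior point because of \<open>sub\<close>.\<close>
  moreover have "c \<noteq> 0"
  proof
    assume "c = 0"
    then have "(\<rho> has_integral 0) (cbox a b)" using int unfolding c_def by (metis integrable_integral)
    moreover have 0: "0 \<in> box a b" using interior_maximal[OF sub] r by (auto simp: interior_cbox)
    moreover have "0 \<in> cbox a b" using 0 box_subset_cbox by (rule subsetD[rotated])
    moreover have "box a b \<noteq> {}" using 0 by force
    moreover have "continuous_on (cbox a b) \<rho>" using cont by (rule continuous_on_subset) simp
    ultimately have "\<rho> 0 = 0" using nn
      by (intro has_integral_0_cbox_imp_0[of a b \<rho> 0])
    then show False using p by simp
  qed
  ultimately have c: "0 < c" by simp
  have "(\<lambda>z. (1 / c) * \<rho> z) \<in> bump_alg (r\<^sup>2)" using alg by (intro bump_alg.mult bump_alg.const)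
  then have "smooth_fun (\<lambda>z. (1 / c) * \<rho> z)" by (rule smooth_fun_bump_alg)
  moreover have "integral (cbox a b) (\<lambda>z. (1 / c) * \<rho> z) = 1"
    using c by (simp add: c_def[symmetric])
  ultimately show ?thesis using c nn z by (intro exI[of _ "\<lambda>z. (1 / c) * \<rho> z"]) auto
qed

text \<open>Moving from \<open>x\<close> along \<open>u = grad g x - p\<close> compares both linear
  approximations of \<open>g\<close>: their difference there is \<open>norm u\<close> times the step
  length, and it is at most \<open>M + e\<close> times that length for every positive
  \<open>e\<close>.\<close>

lemma norm_grad_diff_le:
  fixes g :: "'a::euclidean_space \<Rightarrow> real"
  assumes g: "g differentiable (at x)" and d: "0 < \<delta>"
    and E: "\<And>w. norm w \<le> \<delta> \<Longrightarrow> \<bar>g (x + w) - g x - p \<bullet> w\<bar> \<le> M * norm w"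
  shows "norm (p - grad g x) \<le> M"
proof (cases "p = grad g x")
  case True
  obtain b :: 'a where "b \<in> Basis" using nonempty_Basis by blast
  then have "0 \<le> M * \<delta>" using E[of "\<delta> *\<^sub>R b"] d by (auto intro: order_trans[OF abs_ge_zero])
  then show ?thesis using True d by (simp add: zero_le_mult_iff)
next
  case False
  define u where "u = grad g x - p"
  have u: "0 < norm u" using False by (simp add: u_def)
  have D: "(g has_derivative frechet_derivative g (at x)) (at x)" using g frechet_derivative_works by blast
  have "norm u \<le> M + e" if e: "0 < e" for e
  proof -
    obtain d' where d': "0 < d'" "\<And>y. norm (y - x) < d' \<Longrightarrow>
        \<bar>g y - g x - frechet_derivative g (at x) (y - x)\<bar> \<le> e * norm (y - x)"
      using D e unfolding has_derivative_at_alt real_norm_def by blast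
    \<comment> \<open>The step \<open>s *\<^sub>R u\<close> must be admissible both for
      \<open>E\<close> and for the first-order expansion of \<open>g\<close>.\<close>
    define s where "s = min \<delta> (d' / 2) / norm u"
    have s: "0 < s" using d d' u by (simp add: s_def)
    have ns: "norm (s *\<^sub>R u) = min \<delta> (d' / 2)" using u d d' by (simp add: s_def)
    have 1: "\<bar>g (x + s *\<^sub>R u) - g x - p \<bullet> (s *\<^sub>R u)\<bar> \<le> M * norm (s *\<^sub>R u)" using ns by (intro E) auto
    have 2: "\<bar>g (x + s *\<^sub>R u) - g x - grad g x \<bullet> (s *\<^sub>R u)\<bar> \<le> e * norm (s *\<^sub>R u)"
      using d'(2)[of "x + s *\<^sub>R u"] ns d'(1) unfolding grad_inner[OF g] by simp
    have "u \<bullet> (s *\<^sub>R u) = grad g x \<bullet> (s *\<^sub>R u) - p \<bullet> (s *\<^sub>R u)"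
      by (simp only: u_def inner_diff_left)
    then have "u \<bullet> (s *\<^sub>R u) \<le> M * norm (s *\<^sub>R u) + e * norm (s *\<^sub>R u)" using 1 2 by linarith
    moreover have "u \<bullet> (s *\<^sub>R u) = norm u * norm (s *\<^sub>R u)" using s by (simp add: dot_square_norm power2_eq_square)
    ultimately have "norm u * norm (s *\<^sub>R u) \<le> (M + e) * norm (s *\<^sub>R u)" by (simp add: algebra_simps)
    then show ?thesis using s u by simp
  qed
  then have "norm u \<le> M" by (rule field_le_epsilon)
  then show ?thesis by (simp add: u_def norm_minus_commute)
qed

text \<open>Averaging the increment estimate of \<open>\<psi>\<close> at the points
  \<open>x - z\<close> against a kernel of mass 1 keeps the slope error \<open>M\<close>; replacing
  \<open>\<Phi> (x - z)\<close> by \<open>\<Phi> x\<close> costs \<open>\<eta>\<close>. For the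
  smooth average such an estimate at small increments bounds the gradient.\<close>

lemma mollify:
  fixes \<psi> :: "'a::euclidean_space \<Rightarrow> real" and \<Phi> :: "'a \<Rightarrow> 'a"
  assumes psi: "continuous_on UNIV \<psi>" "\<And>x. R < norm x \<Longrightarrow> \<psi> x = 0"
    and d: "0 < \<delta>" and lip: "\<And>x y. dist x y \<le> \<delta> \<Longrightarrow> \<bar>\<psi> y - \<psi> x - \<Phi> x \<bullet> (y - x)\<bar> \<le> M * dist x y"
    and r: "0 < r" and osc: "\<And>x y. dist x y \<le> r \<Longrightarrow> norm (\<Phi> y - \<Phi> x) \<le> \<eta>"
  shows "\<exists>g. test_fun g \<and> (\<forall>x. norm (\<Phi> x - grad g x) \<le> M + \<eta>)"
proof -
  \<comment> \<open>One symmetric box contains the supports of both factors; the absolute value is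
    there because \<open>R\<close> may be negative.\<close>
  obtain a where a: "cball (0::'a) (\<bar>R\<bar> + r) \<subseteq> cbox (-a) a"
    using bounded_subset_cbox_symmetric[OF bounded_cball] by blast
  let ?Q = "cbox (-a) a"
  have "ball 0 r \<subseteq> ?Q" using a by (auto simp: subset_iff)
  from smooth_kernel[OF r this] obtain \<rho> :: "'a \<Rightarrow> real"
    where sm: "smooth_fun \<rho>" and nn: "\<And>z. 0 \<le> \<rho> z" and z: "\<And>z. r \<le> norm z \<Longrightarrow> \<rho> z = 0"
      and one: "integral ?Q \<rho> = 1" by blast
  have crho: "continuous_on S \<rho>" for S
    using smooth_fun_iter_dderiv_continuous[OF sm, of "[]"] by simp
  have inQ: "x \<in> ?Q" if "norm x \<le> \<bar>R\<bar> + r" for x using a that by (auto simp: subset_iff)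
  have pQ: "\<psi> t = 0" if "t \<notin> ?Q" for t using inQ[of t] that psi(2)[of t] r by fastforce
  have rQ: "\<rho> t = 0" if "t \<notin> ?Q" for t using inQ[of t] that z[of t] by fastforce
  define g where "g = convolve ?Q \<psi> \<rho>"
  have cpsi: "continuous_on S \<psi>" for S using psi(1) continuous_on_subset by blast
  have smg: "smooth_fun g" unfolding g_def by (rule smooth_fun_convolve[OF cpsi sm])
  have ge: "g x = integral ?Q (\<lambda>z. \<psi> (x - z) * \<rho> z)" for x
    unfolding g_def by (rule convolve_commute[OF psi(1) pQ crho rQ])
  have gz: "g x = 0" if "\<bar>R\<bar> + r < norm x" for x
  proof -
    have "\<psi> t * \<rho> (x - t) = 0" for t
    proof (cases "R < norm t")
      case False
      then have "r \<le> norm (x - t)" using that norm_triangle_sub[of x t] by linarith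
      then show ?thesis using z by simp
    qed (simp add: psi(2))
    then have "(\<lambda>t. \<psi> t * \<rho> (x - t)) = (\<lambda>_. 0)" by (rule ext)
    then show ?thesis by (simp add: g_def convolve_def)
  qed
  have "closure {x. g x \<noteq> 0} \<subseteq> cball 0 (\<bar>R\<bar> + r)"
    by (rule closure_minimal) (use gz in \<open>force simp: not_le[symmetric]\<close>)+
  then have "compact (closure {x. g x \<noteq> 0})"
    using bounded_subset[OF bounded_cball] by (auto simp: compact_eq_bounded_closed)
  then have tf: "test_fun g" using smg by (simp add: test_fun_def)
  have E: "\<bar>g (x + w) - g x - \<Phi> x \<bullet> w\<bar> \<le> (M + \<eta>) * norm w" if w: "norm w \<le> \<delta>" for x w
  proof -
    let ?h = "\<lambda>z. (\<psi> (x + w - z) - \<psi> (x - z) - \<Phi> x \<bullet> w) * \<rho> z"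
    have i1: "(\<lambda>z. \<psi> (y - z) * \<rho> z) integrable_on ?Q" for y
      by (intro integrable_continuous continuous_intros continuous_on_compose2[OF psi(1)] crho) auto
    have i2: "\<rho> integrable_on ?Q" by (intro integrable_continuous crho)
    have h: "(?h has_integral (g (x + w) - g x - \<Phi> x \<bullet> w * 1)) ?Q"
      unfolding left_diff_distrib ge one[symmetric]
      by (intro has_integral_diff has_integral_mult_right integrable_integral i1 i2)
    have k: "((\<lambda>z. (M + \<eta>) * norm w * \<rho> z) has_integral ((M + \<eta>) * norm w * 1)) ?Q"
      unfolding one[symmetric] by (intro has_integral_mult_right integrable_integral i2)
    have "norm (?h z) \<le> (M + \<eta>) * norm w * \<rho> z" for z
    proof (cases "r \<le> norm z")
      case False
      have "\<bar>\<psi> (x + w - z) - \<psi> (x - z) - \<Phi> (x - z) \<bullet> w\<bar> \<le> M * norm w"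
        using lip[of "x - z" "x + w - z"] w by (simp add: dist_norm)
      moreover have "\<bar>(\<Phi> (x - z) - \<Phi> x) \<bullet> w\<bar> \<le> \<eta> * norm w"
        using osc[of x "x - z"] False Cauchy_Schwarz_ineq2[of "\<Phi> (x - z) - \<Phi> x" w]
        by (simp add: dist_norm) (meson mult_right_mono norm_ge_zero order_trans)
      ultimately have "\<bar>\<psi> (x + w - z) - \<psi> (x - z) - \<Phi> x \<bullet> w\<bar> \<le> (M + \<eta>) * norm w"
        unfolding inner_diff_left distrib_right by linarith
      then show ?thesis using nn[of z] by (simp add: abs_mult mult_right_mono)
    qed (simp add: z)
    then have "norm (integral ?Q ?h) \<le> integral ?Q (\<lambda>z. (M + \<eta>) * norm w * \<rho> z)"
      using h k by (intro integral_norm_bound_integral) (auto simp: integrable_on_def)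
    then show ?thesis using integral_unique[OF h] integral_unique[OF k] by (simp add: one)
  qed
  have "g differentiable (at x)" for x using smg[unfolded smooth_fun_def, rule_format, of "[]"] by simp
  then have "norm (\<Phi> x - grad g x) \<le> M + \<eta>" for x
    using norm_grad_diff_le[OF _ d E] by blast
  then show ?thesis using tf by blast
qed

subsection \<open>Fields vanishing at infinity and their dual\<close>

lemma C0_fieldsD: "\<Phi> \<in> C0_fields \<Longrightarrow> continuous_on S \<Phi>"
  unfolding C0_fields_def using continuous_on_subset by blast

lemma C0_fields_small:
  assumes "\<Phi> \<in> C0_fields" "0 < e"
  obtains R where "0 < R" "\<And>x. R \<le> norm x \<Longrightarrow> norm (\<Phi> x) < e"
proof -
  have "\<forall>\<^sub>F x in at_infinity. dist (\<Phi> x) 0 < e"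
    using assms unfolding C0_fields_def by (auto simp: tendsto_iff)
  then obtain b where "\<forall>x. b \<le> norm x \<longrightarrow> norm (\<Phi> x) < e"
    unfolding eventually_at_infinity by auto
  then show ?thesis by (intro that[of "max b 1"]) auto
qed

lemma C0_fields_bounded:
  assumes "\<Phi> \<in> C0_fields"
  shows "\<exists>B. \<forall>x. norm (\<Phi> x) \<le> B"
proof -
  obtain R where R: "\<And>x. R \<le> norm x \<Longrightarrow> norm (\<Phi> x) < 1"
    using C0_fields_small[OF assms zero_less_one] by metis
  have "bounded (\<Phi> ` cball 0 R)"
    by (intro compact_imp_bounded compact_continuous_image C0_fieldsD assms compact_cball)
  then obtain b where b: "\<forall>y\<in>\<Phi> ` cball 0 R. norm y \<le> b" unfolding bounded_iff by blast
  have "norm (\<Phi> x) \<le> max b 1" for x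
  proof (cases "norm x \<le> R")
    case True
    then have "norm (\<Phi> x) \<le> b" using b by simp
    then show ?thesis by simp
  next
    case False
    then have "norm (\<Phi> x) < 1" by (intro R) simp
    then show ?thesis by simp
  qed
  then show ?thesis by blast
qed

lemma norm_le_sup_norm: "\<Phi> \<in> C0_fields \<Longrightarrow> norm (\<Phi> x) \<le> sup_norm \<Phi>"
  unfolding sup_norm_def using C0_fields_bounded[of \<Phi>] by (auto intro!: cSUP_upper intro: bdd_aboveI2)

lemma sup_norm_le: "(\<And>x. norm (\<Phi> x) \<le> c) \<Longrightarrow> sup_norm \<Phi> \<le> c"
  unfolding sup_norm_def by (rule cSUP_least) auto

lemma sup_norm_nonneg: "\<Phi> \<in> C0_fields \<Longrightarrow> 0 \<le> sup_norm \<Phi>"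
  using norm_le_sup_norm[of \<Phi> 0] norm_ge_zero order_trans by blast

lemma C0_fields_zero: "(\<lambda>x. 0) \<in> C0_fields"
  by (simp add: C0_fields_def)

lemma C0_fields_add: "\<Phi> \<in> C0_fields \<Longrightarrow> \<Psi> \<in> C0_fields \<Longrightarrow> (\<lambda>x. \<Phi> x + \<Psi> x) \<in> C0_fields"
  unfolding C0_fields_def by (auto intro: continuous_intros tendsto_add_zero)

lemma C0_fields_scaleR: "\<Phi> \<in> C0_fields \<Longrightarrow> (\<lambda>x. c *\<^sub>R \<Phi> x) \<in> C0_fields"
  unfolding C0_fields_def by (auto intro!: continuous_intros tendsto_eq_intros)

lemma C0_fields_diff: "\<Phi> \<in> C0_fields \<Longrightarrow> \<Psi> \<in> C0_fields \<Longrightarrow> (\<lambda>x. \<Phi> x - \<Psi> x) \<in> C0_fields"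
  unfolding C0_fields_def by (auto intro!: continuous_intros tendsto_eq_intros)

lemma C0_fields_uniform:
  assumes "\<Phi> \<in> C0_fields" "0 < e"
  obtains d where "0 < d" "\<And>x y. dist x y \<le> d \<Longrightarrow> norm (\<Phi> y - \<Phi> x) \<le> e"
proof -
  obtain R where R: "0 < R" "\<And>x. R \<le> norm x \<Longrightarrow> norm (\<Phi> x) < e / 2"
    using C0_fields_small[OF assms(1), of "e / 2"] assms by auto
  have "uniformly_continuous_on (cball 0 (R + 1)) \<Phi>"
    by (intro compact_uniformly_continuous C0_fieldsD assms compact_cball)
  then obtain d where d: "0 < d" "\<And>x y. x \<in> cball 0 (R + 1) \<Longrightarrow> y \<in> cball 0 (R + 1) \<Longrightarrow> dist y x < d \<Longrightarrow> dist (\<Phi> y) (\<Phi> x) < e"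
    unfolding uniformly_continuous_on_def using assms(2) by metis
  show ?thesis
  \<comment> \<open>The cap 1 keeps both points in the ball of radius \<open>R + 1\<close> once one
    of them has norm at most \<open>R\<close>; halving \<open>d\<close> turns the strict condition
    into a weak one.\<close>
  proof (rule that[of "min 1 (d / 2)"])
    fix x y :: 'a assume xy: "dist x y \<le> min 1 (d / 2)"
    show "norm (\<Phi> y - \<Phi> x) \<le> e"
    proof (cases "norm x \<le> R \<or> norm y \<le> R")
      case True
      have "norm x \<le> norm y + dist x y" "norm y \<le> norm x + dist x y"
        unfolding dist_norm using norm_triangle_sub[of x y] norm_triangle_sub[of y x]
        by (auto simp: norm_minus_commute)
      then have "norm x \<le> R + 1" "norm y \<le> R + 1" using True xy by auto
      moreover have "dist y x < d" using xy d(1) by (simp add: dist_commute min_def split: if_splits)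
      ultimately have "dist (\<Phi> y) (\<Phi> x) < e" by (intro d(2)) auto
      then show ?thesis by (simp add: dist_norm)
    next
      case False
      then have "norm (\<Phi> x) < e / 2" "norm (\<Phi> y) < e / 2" using R(2)[of x] R(2)[of y] by auto
      then show ?thesis using norm_triangle_ineq4[of "\<Phi> y" "\<Phi> x"] by linarith
    qed
  qed (use d in auto)
qed

section \<open>Linearity and the dual norm\<close>

lemma functional_add:
  "vector_radon_measure F \<Longrightarrow> \<Phi> \<in> C0_fields \<Longrightarrow> \<Psi> \<in> C0_fields \<Longrightarrow>
    F (\<lambda>x. \<Phi> x + \<Psi> x) = F \<Phi> + F \<Psi>"
  by (simp add: vector_radon_measure_def)

lemma functional_scaleR:
  "vector_radon_measure F \<Longrightarrow> \<Phi> \<in> C0_fields \<Longrightarrow> F (\<lambda>x. c *\<^sub>R \<Phi> x) = c * F \<Phi>"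
  by (simp add: vector_radon_measure_def)

lemma functional_diff:
  assumes "vector_radon_measure F" "\<Phi> \<in> C0_fields" "\<Psi> \<in> C0_fields"
  shows "F (\<lambda>x. \<Phi> x - \<Psi> x) = F \<Phi> - F \<Psi>"
  using functional_add[OF assms(1) C0_fields_diff[OF assms(2,3)] assms(3)] by simp

lemma measure_norm_bdd:
  assumes "vector_radon_measure F"
  shows "bdd_above {\<bar>F \<Psi>\<bar> | \<Psi>. \<Psi> \<in> C0_fields \<and> sup_norm \<Psi> \<le> 1}"
proof -
  obtain B where B: "\<And>\<Psi>. \<Psi> \<in> C0_fields \<Longrightarrow> \<bar>F \<Psi>\<bar> \<le> B * sup_norm \<Psi>"
    using assms unfolding vector_radon_measure_def by blast
  show ?thesis
  proof (rule bdd_aboveI)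
    fix z assume "z \<in> {\<bar>F \<Psi>\<bar> | \<Psi>. \<Psi> \<in> C0_fields \<and> sup_norm \<Psi> \<le> 1}"
    then obtain \<Psi> where P: "z = \<bar>F \<Psi>\<bar>" "\<Psi> \<in> C0_fields" "sup_norm \<Psi> \<le> 1" by blast
    have "z \<le> B * sup_norm \<Psi>" using B P by simp
    also have "\<dots> \<le> \<bar>B\<bar> * 1" using P sup_norm_nonneg[OF P(2)] by (intro mult_mono) auto
    finally show "z \<le> \<bar>B\<bar>" by simp
  qed
qed

lemma measure_norm_bound:
  assumes F: "vector_radon_measure F" and Phi: "\<Phi> \<in> C0_fields"
  shows "\<bar>F \<Phi>\<bar> \<le> measure_norm F * sup_norm \<Phi>"
proof -
  have sc: "F (\<lambda>x. c *\<^sub>R \<Phi> x) = c * F \<Phi>" for c using F Phi unfolding vector_radon_measure_def by blast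
  have le: "\<bar>F \<Psi>\<bar> \<le> measure_norm F" if "\<Psi> \<in> C0_fields" "sup_norm \<Psi> \<le> 1" for \<Psi>
    unfolding measure_norm_def using that by (intro cSup_upper[OF _ measure_norm_bdd[OF F]]) blast
  show ?thesis
  proof (cases "sup_norm \<Phi> = 0")
    case True
    then have "norm (\<Phi> x) \<le> 0" for x using norm_le_sup_norm[OF Phi, of x] by simp
    then have "\<Phi> = (\<lambda>x. 0 *\<^sub>R \<Phi> x)" by auto
    then have "F \<Phi> = 0" using sc[of 0] by simp
    then show ?thesis using True by simp
  next
    case False
    then have p: "0 < sup_norm \<Phi>" using sup_norm_nonneg[OF Phi] by simp
    have "\<bar>F (\<lambda>x. (1 / sup_norm \<Phi>) *\<^sub>R \<Phi> x)\<bar> \<le> measure_norm F"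
    proof (rule le[OF C0_fields_scaleR[OF Phi]], rule sup_norm_le)
      fix x show "norm ((1 / sup_norm \<Phi>) *\<^sub>R \<Phi> x) \<le> 1"
        using norm_le_sup_norm[OF Phi, of x] p by simp
    qed
    then show ?thesis using p by (simp add: sc abs_mult divide_simps mult_ac)
  qed
qed

lemma measure_norm_nonneg:
  assumes "vector_radon_measure F"
  shows "0 \<le> measure_norm F"
proof -
  have "sup_norm (\<lambda>x::'a. 0::'a) \<le> 1" by (rule sup_norm_le) simp
  then have "\<bar>F (\<lambda>x. 0)\<bar> \<le> measure_norm F"
    unfolding measure_norm_def
    by (intro cSup_upper measure_norm_bdd[OF assms]) (use C0_fields_zero in blast)
  then show ?thesis by linarith
qed

subsection \<open>The critical value\<close>

text \<open>A polygonal path with steps at most \<open>d\<close>: \<open>s\<close> is its length and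
  \<open>v\<close> the left-endpoint Riemann sum of the line integral of
  \<open>\<Phi>\<close>.\<close>

inductive chain :: "('a::euclidean_space \<Rightarrow> 'a) \<Rightarrow> real \<Rightarrow> 'a \<Rightarrow> 'a \<Rightarrow> real \<Rightarrow> real \<Rightarrow> bool" for \<Phi> d x where
  Nil: "chain \<Phi> d x x 0 0"
| Snoc: "chain \<Phi> d x y s v \<Longrightarrow> dist y z \<le> d \<Longrightarrow> chain \<Phi> d x z (s + dist y z) (v + \<Phi> y \<bullet> (z - y))"

lemma chain_trans:
  assumes "chain \<Phi> d y z t w" "chain \<Phi> d x y s v"
  shows "chain \<Phi> d x z (s + t) (v + w)"
  using assms(1)
proof induction
  case (Snoc y' t w z)
  from chain.Snoc[OF Snoc.IH Snoc.hyps(2)] show ?case by (simp add: add.assoc)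
qed (use assms(2) in simp)

text \<open>Ensures that a loop with \<open>v > M * s\<close> has positive length, so that it can
  serve as a loop to be repeated.\<close>

lemma chain_zero:
  assumes "chain \<Phi> d x y s v"
  shows "0 \<le> s \<and> (s = 0 \<longrightarrow> v = 0)"
  using assms
proof induction
  case (Snoc y s v z)
  then show ?case using zero_le_dist[of y z] by (auto simp: add_nonneg_eq_0_iff)
qed simp

lemma chain_connected:
  assumes "0 < d"
  shows "\<exists>s v. chain \<Phi> d x y s v"
proof -
  obtain n where n: "dist x y / d \<le> real n" using real_arch_simple by blast
  define p where "p k = x + (real k / real (Suc n)) *\<^sub>R (y - x)" for k
  have "dist (p k) (p (Suc k)) \<le> d" for k
  proof -
    have "p (Suc k) - p k = (1 / real (Suc n)) *\<^sub>R (y - x)"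
      by (simp add: p_def add_divide_distrib flip: scaleR_left_diff_distrib)
    then have "dist (p k) (p (Suc k)) = dist x y / real (Suc n)"
      unfolding dist_norm by (metis norm_minus_commute norm_scaleR abs_of_nonneg divide_inverse
        mult.commute mult_1 of_nat_0_le_iff inverse_nonnegative_iff_nonnegative)
    also have "\<dots> \<le> d" using n assms by (simp add: divide_simps) (simp add: algebra_simps)
    finally show ?thesis .
  qed
  then have "\<exists>s v. chain \<Phi> d x (p k) s v" for k
  proof (induction k)
    case 0
    have "p 0 = x" by (simp add: p_def)
    then show ?case using chain.Nil by metis
  next
    case (Suc k)
    then show ?case using chain.Snoc by metis
  qed
  from this[of "Suc n"] show ?thesis by (simp add: p_def)
qed

text \<open>The potential at \<open>y\<close> is the supremum of \<open>v - M * s\<close> over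
  chains from 0 to \<open>y\<close>. It is finite since a fixed chain back to 0 closes every such
  chain to a loop. Appending the edge from \<open>x\<close> to \<open>y\<close> gives one
  inequality; the reversed edge gives the other, with \<open>\<Phi> y\<close> in place of
  \<open>\<Phi> x\<close>, hence the extra \<open>\<eta>\<close>.\<close>

lemma chain_potential:
  fixes \<Phi> :: "'a::euclidean_space \<Rightarrow> 'a"
  assumes d: "0 < d" and loops: "\<And>x s v. chain \<Phi> d x x s v \<Longrightarrow> v \<le> M * s"
    and osc: "\<And>x y. dist x y \<le> d \<Longrightarrow> norm (\<Phi> y - \<Phi> x) \<le> \<eta>"
  shows "\<exists>\<phi>::'a \<Rightarrow> real. \<forall>x y. dist x y \<le> d \<longrightarrow> \<bar>\<phi> y - \<phi> x - \<Phi> x \<bullet> (y - x)\<bar> \<le> (M + \<eta>) * dist x y"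
proof -
  define A where "A y = {v - M * s | s v. chain \<Phi> d 0 y s v}" for y
  define \<phi> where "\<phi> y = Sup (A y)" for y
  have ne: "A y \<noteq> {}" for y using chain_connected[OF d, of \<Phi> 0 y] unfolding A_def by blast
  have bdd: "bdd_above (A y)" for y
  proof -
    obtain t w where tw: "chain \<Phi> d y 0 t w" using chain_connected[OF d] by blast
    show ?thesis
    proof (rule bdd_aboveI)
      fix u assume "u \<in> A y"
      then obtain s v where sv: "chain \<Phi> d 0 y s v" "u = v - M * s" unfolding A_def by blast
      have "v + w \<le> M * (s + t)" using loops[OF chain_trans[OF tw sv(1)]] .
      then show "u \<le> M * t - w" using sv(2) by (simp add: algebra_simps)
    qed
  qed
  have step: "\<phi> x + (\<Phi> x \<bullet> (y - x) - M * dist x y) \<le> \<phi> y" if "dist x y \<le> d" for x y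
  proof -
    have "u \<le> \<phi> y - (\<Phi> x \<bullet> (y - x) - M * dist x y)" if "u \<in> A x" for u
    proof -
      obtain s v where sv: "chain \<Phi> d 0 x s v" "u = v - M * s" using \<open>u \<in> A x\<close> unfolding A_def by blast
      have "(v + \<Phi> x \<bullet> (y - x)) - M * (s + dist x y) \<in> A y"
        using chain.Snoc[OF sv(1) \<open>dist x y \<le> d\<close>] unfolding A_def by blast
      then have "(v + \<Phi> x \<bullet> (y - x)) - M * (s + dist x y) \<le> \<phi> y"
        unfolding \<phi>_def by (rule cSup_upper[OF _ bdd])
      then show ?thesis using sv(2) by (simp add: algebra_simps)
    qed
    then have "\<phi> x \<le> \<phi> y - (\<Phi> x \<bullet> (y - x) - M * dist x y)"
      unfolding \<phi>_def[of x] by (rule cSup_least[OF ne])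
    then show ?thesis by simp
  qed
  show ?thesis
  proof (intro exI[of _ \<phi>] allI impI)
    fix x y :: 'a assume xy: "dist x y \<le> d"
    have yx: "dist y x \<le> d" using xy by (simp add: dist_commute)
    have "(\<Phi> y - \<Phi> x) \<bullet> (y - x) \<le> norm (\<Phi> y - \<Phi> x) * norm (y - x)" by (rule norm_cauchy_schwarz)
    also have "\<dots> \<le> \<eta> * dist x y"
      using osc[OF xy] by (simp add: dist_norm norm_minus_commute mult_right_mono)
    finally have "\<Phi> y \<bullet> (y - x) \<le> \<Phi> x \<bullet> (y - x) + \<eta> * dist x y" by (simp add: inner_diff_left)
    moreover have "\<Phi> y \<bullet> (x - y) = - (\<Phi> y \<bullet> (y - x))" by (simp add: inner_diff_right)
    moreover have "0 \<le> \<eta> * dist x y" using osc[of x x] d by simp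
    ultimately show "\<bar>\<phi> y - \<phi> x - \<Phi> x \<bullet> (y - x)\<bar> \<le> (M + \<eta>) * dist x y"
      using step[OF xy] step[OF yx] by (simp add: dist_commute[of y x] distrib_right)
  qed
qed

text \<open>Clamping is nonexpansive jointly in the value and in the bounds, so the cut-off inherits
  a common Lipschitz bound of the potential and the cone.\<close>

lemma clamp_diff_le:
  fixes a b h k c :: real
  assumes "\<bar>b - a\<bar> \<le> c" "\<bar>k - h\<bar> \<le> c"
  shows "\<bar>max (-k) (min b k) - max (-h) (min a h)\<bar> \<le> c"
  using assms by (auto simp: max_def min_def abs_if split: if_splits)

text \<open>Outside a large ball \<open>\<Phi>\<close> is small, so clamping the potential between two cones of slope about
  \<open>M\<close> makes it compactly supported without spoiling the bound on its distance to \<open>\<Phi>\<close>. Mollifying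
  then gives a test function whose gradient is uniformly within about \<open>M\<close> of \<open>\<Phi>\<close>.\<close>
lemma functional_le_critical_value:
  fixes F :: "('a::euclidean_space \<Rightarrow> 'a) \<Rightarrow> real"
  assumes F: "vector_radon_measure F" "div_free F" and Phi: "\<Phi> \<in> C0_fields"
    and d: "0 < d" and loops: "\<And>x s v. chain \<Phi> d x x s v \<Longrightarrow> v \<le> M * s"
    and osc: "\<And>x y. dist x y \<le> d \<Longrightarrow> norm (\<Phi> y - \<Phi> x) \<le> \<eta>" and eta: "0 < \<eta>"
  shows "F \<Phi> \<le> measure_norm F * (M + 6 * \<eta>)"
proof -
  have "\<exists>\<phi>::'a \<Rightarrow> real. \<forall>x y. dist x y \<le> d \<longrightarrow> \<bar>\<phi> y - \<phi> x - \<Phi> x \<bullet> (y - x)\<bar> \<le> (M + \<eta>) * dist x y"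
    by (rule chain_potential[OF d]; (rule loops | rule osc); assumption)
  then obtain \<phi> :: "'a \<Rightarrow> real" where phi: "\<And>x y. dist x y \<le> d \<Longrightarrow> \<bar>\<phi> y - \<phi> x - \<Phi> x \<bullet> (y - x)\<bar> \<le> (M + \<eta>) * dist x y"
    by blast
  obtain b :: 'a where b: "b \<in> Basis" using nonempty_Basis by blast
  have "0 \<le> (M + \<eta>) * d"
    using phi[of 0 "d *\<^sub>R b"] b d by (auto intro: order_trans[OF abs_ge_zero])
  then have M0: "0 \<le> M + \<eta>" using d by (simp add: zero_le_mult_iff)
  \<comment> \<open>So far only \<open>0 \<le> M + \<eta>\<close> is known. Another
    \<open>\<eta>\<close> makes the slope positive, so the cone \<open>h\<close> comes down to zero
    at a finite radius.\<close>
  define M' where "M' = M + 2 * \<eta>"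
  have M': "0 < M'" using M0 eta by (simp add: M'_def)
  have lip: "\<bar>\<phi> y - \<phi> x\<bar> \<le> (M + \<eta> + norm (\<Phi> x)) * dist x y" if "dist x y \<le> d" for x y
  proof -
    have "\<bar>\<Phi> x \<bullet> (y - x)\<bar> \<le> norm (\<Phi> x) * dist x y"
      using Cauchy_Schwarz_ineq2[of "\<Phi> x" "y - x"] by (simp add: dist_norm norm_minus_commute)
    then show ?thesis using phi[OF that] unfolding distrib_right by linarith
  qed
  have cont: "continuous_on UNIV \<phi>"
    unfolding continuous_on_iff
  proof (intro ballI allI impI)
    fix x :: 'a and e :: real assume e: "0 < e"
    define C where "C = M + \<eta> + norm (\<Phi> x) + 1"
    have C: "0 < C" using M0 norm_ge_zero[of "\<Phi> x"] unfolding C_def by linarith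
    show "\<exists>d>0. \<forall>x'\<in>UNIV. dist x' x < d \<longrightarrow> dist (\<phi> x') (\<phi> x) < e"
    proof (intro exI[of _ "min d (e / C)"] conjI ballI impI)
      fix y assume y: "dist y x < min d (e / C)"
      have "dist (\<phi> y) (\<phi> x) \<le> (M + \<eta> + norm (\<Phi> x)) * dist x y"
        using lip[of x y] y by (simp add: dist_real_def dist_commute)
      also have "\<dots> \<le> C * dist x y" by (intro mult_right_mono) (auto simp: C_def)
      also have "\<dots> < e" using y C by (simp add: dist_commute pos_less_divide_eq mult.commute)
      finally show "dist (\<phi> y) (\<phi> x) < e" .
    qed (use d e C in auto)
  qed
  obtain R where R: "0 < R" "\<And>x. R \<le> norm x \<Longrightarrow> norm (\<Phi> x) < \<eta>"
    using C0_fields_small[OF Phi eta] by blast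
  have "bounded (\<phi> ` cball 0 R)"
    by (intro compact_imp_bounded compact_continuous_image continuous_on_subset[OF cont] compact_cball) auto
  then obtain K where K: "\<forall>z\<in>\<phi> ` cball 0 R. norm z \<le> K" unfolding bounded_iff by blast
  have K: "\<bar>\<phi> x\<bar> \<le> K" if "norm x \<le> R" for x using K that by auto
  have K0: "0 \<le> K" using K[of 0] R(1) by simp
  define h where "h x = max 0 (K + M' * (R - norm x))" for x :: 'a
  define \<psi> where "\<psi> x = max (- h x) (min (\<phi> x) (h x))" for x
  have cpsi: "continuous_on UNIV \<psi>"
    unfolding \<psi>_def h_def by (intro continuous_intros cont)
  have h_in: "K \<le> h x" if "norm x \<le> R" for x using that M' by (simp add: h_def le_max_iff_disj)
  have psi_in: "\<psi> x = \<phi> x" if "norm x \<le> R" for x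
    using K[OF that] h_in[OF that] by (simp add: \<psi>_def max_def min_def abs_le_iff)
  have psi_out: "\<psi> x = 0" if "R + K / M' < norm x" for x
  proof -
    have "K / M' < norm x - R" using that by linarith
    then have "K < (norm x - R) * M'" using M' by (simp add: pos_divide_less_eq)
    then have "h x = 0" by (simp add: h_def algebra_simps)
    then show ?thesis by (simp add: \<psi>_def)
  qed
  have hlip: "\<bar>h y - h x\<bar> \<le> M' * dist x y" for x y
  proof -
    have "\<bar>h y - h x\<bar> \<le> \<bar>M' * (norm y - norm x)\<bar>"
      unfolding h_def by (auto simp: max_def abs_if right_diff_distrib)
    also have "\<dots> \<le> M' * dist x y"
      using M' norm_triangle_ineq3[of y x] by (simp add: abs_mult dist_norm norm_minus_commute)
    finally show ?thesis .
  qed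
  have psi: "\<bar>\<psi> y - \<psi> x - \<Phi> x \<bullet> (y - x)\<bar> \<le> (M + 5 * \<eta>) * dist x y" if xy: "dist x y \<le> d" for x y
  proof (cases "norm x \<le> R \<and> norm y \<le> R")
    case True
    have "(M + \<eta>) * dist x y \<le> (M + 5 * \<eta>) * dist x y" using eta by (intro mult_right_mono) auto
    then show ?thesis using True phi[OF xy] by (simp add: psi_in)
  next
    case False
    have "norm (\<Phi> x) \<le> norm (\<Phi> y) + \<eta>"
      using osc[OF xy] norm_triangle_sub[of "\<Phi> x" "\<Phi> y"] by (simp add: norm_minus_commute)
    \<comment> \<open>If only \<open>y\<close> lies outside the ball, the oscillation bound
      transfers smallness to \<open>x\<close>. Then \<open>lip\<close> gives slope
      \<open>M + 3 * \<eta>\<close>, the term with \<open>\<Phi> x\<close> adds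
      \<open>2 * \<eta>\<close>, and mollification later adds the sixth
      \<open>\<eta>\<close>.\<close>
    then have n: "norm (\<Phi> x) \<le> 2 * \<eta>" using R(2)[of x] R(2)[of y] False eta by fastforce
    have "(M + \<eta> + norm (\<Phi> x)) * dist x y \<le> (M + 3 * \<eta>) * dist x y" using n by (intro mult_right_mono) auto
    then have 1: "\<bar>\<phi> y - \<phi> x\<bar> \<le> (M + 3 * \<eta>) * dist x y" using lip[OF xy] by linarith
    have "M' * dist x y \<le> (M + 3 * \<eta>) * dist x y" using eta by (intro mult_right_mono) (auto simp: M'_def)
    then have 2: "\<bar>h y - h x\<bar> \<le> (M + 3 * \<eta>) * dist x y" using hlip[of y x] by linarith
    have 3: "\<bar>\<psi> y - \<psi> x\<bar> \<le> (M + 3 * \<eta>) * dist x y" unfolding \<psi>_def by (rule clamp_diff_le[OF 1 2])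
    have "\<bar>\<Phi> x \<bullet> (y - x)\<bar> \<le> norm (\<Phi> x) * dist x y"
      using Cauchy_Schwarz_ineq2[of "\<Phi> x" "y - x"] by (simp add: dist_norm norm_minus_commute)
    also have "\<dots> \<le> (2 * \<eta>) * dist x y" using n by (intro mult_right_mono) auto
    finally have "\<bar>\<psi> y - \<psi> x - \<Phi> x \<bullet> (y - x)\<bar> \<le> (M + 3 * \<eta>) * dist x y + (2 * \<eta>) * dist x y"
      using 3 by linarith
    also have "\<dots> = (M + 5 * \<eta>) * dist x y" by (simp add: algebra_simps)
    finally show ?thesis .
  qed
  obtain g where g: "test_fun g" "\<And>x. norm (\<Phi> x - grad g x) \<le> (M + 5 * \<eta>) + \<eta>"
    using mollify[OF cpsi psi_out d psi d osc] by blast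
  have gC: "grad g \<in> C0_fields" using grad_test_fun_C0[OF g(1)] .
  have D: "(\<lambda>x. \<Phi> x - grad g x) \<in> C0_fields" by (rule C0_fields_diff[OF Phi gC])
  have "F (\<lambda>x. (\<Phi> x - grad g x) + grad g x) = F (\<lambda>x. \<Phi> x - grad g x) + F (grad g)"
    by (rule functional_add[OF F(1) D gC])
  moreover have "F (grad g) = 0" using F(2) g(1) unfolding div_free_def by blast
  ultimately have "F \<Phi> = F (\<lambda>x. \<Phi> x - grad g x)" by simp
  also have "\<dots> \<le> measure_norm F * sup_norm (\<lambda>x. \<Phi> x - grad g x)"
    using measure_norm_bound[OF F(1) D] by linarith
  also have "\<dots> \<le> measure_norm F * (M + 6 * \<eta>)"
  proof (rule mult_left_mono[OF sup_norm_le measure_norm_nonneg[OF F(1)]])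
    fix x show "norm (\<Phi> x - grad g x) \<le> M + 6 * \<eta>" using g(2)[of x] by linarith
  qed
  finally show ?thesis .
qed

text \<open>Each edge loses \<open>\<eta>\<close> per unit length through oscillation. The budget
  for turns is halved at every edge, so \<open>\<tau>\<close> bounds the total cost whatever the
  number of edges.\<close>

lemma chain_arc:
  fixes \<Phi> :: "'a::euclidean_space \<Rightarrow> 'a"
  assumes dim: "DIM('a) \<ge> 2" and Phi: "continuous_on UNIV \<Phi>" and B: "\<And>z. norm (\<Phi> z) \<le> B"
    and a: "norm a = 1"
    and osc: "\<And>x y. dist x y \<le> d \<Longrightarrow> norm (\<Phi> y - \<Phi> x) \<le> \<eta>"
    and "chain \<Phi> d x y s v" and "0 < \<tau>"
  shows "\<exists>L I. C1_arc \<Phi> x a y a L I \<and> s \<le> L \<and> L \<le> s + \<tau> \<and> v - \<eta> * s - \<tau> \<le> I"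
  using \<open>chain \<Phi> d x y s v\<close> \<open>0 < \<tau>\<close>
proof (induction arbitrary: \<tau>)
  have B0: "0 \<le> B" using B[of 0] norm_ge_zero order_trans by blast
  then have B1: "1 + B \<noteq> 0" by linarith
  {
    case Nil
    \<comment> \<open>An arc has positive length, so even the empty chain becomes a short closed
      turn, with \<open>\<sigma> + B * \<sigma> = \<tau>\<close>.\<close>
    define \<sigma> where "\<sigma> = \<tau> / (1 + B)"
    have s: "0 < \<sigma>" using Nil B0 by (simp add: \<sigma>_def)
    have "\<sigma> * (1 + B) = \<tau>" using B1 by (simp add: \<sigma>_def)
    then have "\<sigma> + B * \<sigma> = \<tau>" by (simp add: algebra_simps)
    moreover have "0 \<le> B * \<sigma>" using B0 s by simp
    moreover obtain I where I: "C1_arc \<Phi> x a x a \<sigma> I" using C1_arc_turn[OF dim Phi a a s] by blast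
    moreover have "\<bar>I\<bar> \<le> B * \<sigma>" using C1_arc_integral_le[OF I B] .
    ultimately show ?case using s by (intro exI[of _ \<sigma>] exI[of _ I]) auto
  next
    case (Snoc y s v z)
    show ?case
    proof (cases "y = z")
      case True
      then show ?thesis using Snoc.IH[OF Snoc.prems] by simp
    next
      case False
      have "0 < \<tau> / 2" using Snoc.prems by simp
      from Snoc.IH[OF this] obtain L I where I: "C1_arc \<Phi> x a y a L I" "s \<le> L" "L \<le> s + \<tau> / 2" "v - \<eta> * s - \<tau> / 2 \<le> I"
        by blast
      \<comment> \<open>Two turns add \<open>2 * \<sigma>\<close> to the length and cost
        \<open>2 * B * \<sigma>\<close> of integral; together this is exactly the remaining
        \<open>\<tau> / 2\<close>.\<close>
      define \<sigma> where "\<sigma> = \<tau> / 4 / (1 + B)"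
      have s: "0 < \<sigma>" using Snoc.prems B0 by (simp add: \<sigma>_def)
      have "\<sigma> * (1 + B) = \<tau> / 4"
        unfolding \<sigma>_def by (rule nonzero_eq_divide_eq[OF B1, THEN iffD1]) (rule refl)
      then have e: "2 * \<sigma> + 2 * B * \<sigma> = \<tau> / 2" by (simp add: algebra_simps)
      have p: "0 \<le> B * \<sigma>" using B0 s by simp
      have o: "norm (\<Phi> w - \<Phi> y) \<le> \<eta>" if "dist y w \<le> dist y z" for w
        using that Snoc.hyps(2) by (intro osc) simp
      obtain J where J: "C1_arc \<Phi> y a z a (dist y z + 2 * \<sigma>) J"
          "\<Phi> y \<bullet> (z - y) - \<eta> * dist y z - 2 * B * \<sigma> \<le> J"
        using C1_arc_edge[OF dim Phi B a False s o] by blast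
      show ?thesis
        using C1_arc_join[OF I(1) J(1)] I J(2) e p s
        by (intro exI[of _ "L + (dist y z + 2 * \<sigma>)"] exI[of _ "I + J"]) (auto simp: algebra_simps)
    qed
  }
qed

text \<open>Whole copies of the loop are followed by a closed turn filling the remainder, which is
  shorter than \<open>L\<close>. The loss is therefore independent of \<open>l\<close> and
  negligible per unit length.\<close>

lemma C1_arc_pad:
  fixes \<Phi> :: "'a::euclidean_space \<Rightarrow> 'a"
  assumes dim: "DIM('a) \<ge> 2" and Phi: "continuous_on UNIV \<Phi>" and B: "\<And>z. norm (\<Phi> z) \<le> B"
    and a: "norm a = 1" and A: "C1_arc \<Phi> x a x a L I" and I: "c * L \<le> I" and l: "L \<le> l"
  shows "\<exists>J. C1_arc \<Phi> x a x a l J \<and> c * l - (\<bar>c\<bar> + B) * L \<le> J"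
proof -
  have L: "0 < L" using A by (rule C1_arc_pos)
  have B0: "0 \<le> B" using B[of 0] norm_ge_zero order_trans by blast
  \<comment> \<open>One less than the number of copies, since \<open>C1_arc_repeat\<close> counts by
    \<open>Suc k\<close>.\<close>
  define k where "k = nat \<lfloor>l / L\<rfloor> - 1"
  have "1 \<le> \<lfloor>l / L\<rfloor>" using L l by (simp add: le_floor_iff)
  then have "real (Suc k) = of_int \<lfloor>l / L\<rfloor>" by (simp add: k_def of_nat_diff)
  then have "real (Suc k) \<le> l / L" "l / L < real (Suc k) + 1" by linarith+
  then have k: "real (Suc k) * L \<le> l" "l < real (Suc k) * L + L"
    using L by (simp_all add: pos_le_divide_eq pos_divide_less_eq distrib_right)
  define r where "r = l - real (Suc k) * L"
  have r: "0 \<le> r" "r < L" using k by (auto simp: r_def)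
  have R: "C1_arc \<Phi> x a x a (real (Suc k) * L) (real (Suc k) * I)" using C1_arc_repeat[OF A] .
  have "real (Suc k) * (c * L) \<le> real (Suc k) * I" using I by (intro mult_left_mono) auto
  then have g: "c * (l - r) \<le> real (Suc k) * I" by (simp add: r_def mult_ac)
  have "c * r \<le> \<bar>c\<bar> * L" using r by (intro mult_mono) auto
  moreover have "0 \<le> B * L" "B * r \<le> B * L" using B0 L r by (auto intro: mult_left_mono)
  ultimately have e: "c * l - (\<bar>c\<bar> + B) * L \<le> c * (l - r) - B * L" "B * r \<le> B * L" "0 \<le> B * L"
    by (auto simp: algebra_simps)
  show ?thesis
  proof (cases "r = 0")
    case True
    then have "real (Suc k) * L = l" by (simp add: r_def)
    then show ?thesis using R g e by (intro exI[of _ "real (Suc k) * I"]) auto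
  next
    case False
    then have "0 < r" using r by simp
    then obtain J where J: "C1_arc \<Phi> x a x a r J" using C1_arc_turn[OF dim Phi a a] by blast
    have "\<bar>J\<bar> \<le> B * r" using C1_arc_integral_le[OF J B] .
    moreover have "real (Suc k) * L + r = l" by (simp add: r_def)
    ultimately show ?thesis using C1_arc_join[OF R J] g e by (intro exI[of _ "real (Suc k) * I + J"]) auto
  qed
qed

text \<open>Contrapositive of \<open>functional_le_critical_value\<close>: for \<open>M\<close>
  slightly below \<open>F \<Phi> / N\<close> the loop condition must fail, and a violating chain is
  rounded to a curve and padded. If the norm is zero, any closed curve will do.\<close>

lemma closed_curve_near_critical:
  fixes F :: "('a::euclidean_space \<Rightarrow> 'a) \<Rightarrow> real"
  assumes dim: "DIM('a) \<ge> 2" and F: "vector_radon_measure F" "div_free F"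
    and Phi: "\<Phi> \<in> C0_fields" and e: "0 < \<epsilon>"
  shows "\<exists>l0. \<forall>l\<ge>l0. \<exists>\<gamma>. arclength_C1_closed_curve \<gamma> l \<and>
     F \<Phi> - \<epsilon> \<le> measure_norm F * (curve_measure \<gamma> l \<Phi> / l)"
proof -
  obtain B where B: "\<And>x. norm (\<Phi> x) \<le> B" using C0_fields_bounded[OF Phi] by blast
  have cont: "continuous_on UNIV \<Phi>" using C0_fieldsD[OF Phi] .
  obtain a :: 'a where "a \<in> Basis" using nonempty_Basis by blast
  then have a: "norm a = 1" by simp
  define N where "N = measure_norm F"
  show ?thesis
  proof (cases "N = 0")
    case True
    then have F0: "F \<Phi> \<le> 0" using measure_norm_bound[OF F(1) Phi] by (simp add: N_def)
    have "\<exists>\<gamma>. arclength_C1_closed_curve \<gamma> l \<and> F \<Phi> - \<epsilon> \<le> N * (curve_measure \<gamma> l \<Phi> / l)" if "1 \<le> l" for l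
    proof -
      have "0 < l" using that by simp
      then obtain I where "C1_arc \<Phi> 0 a 0 a l I" using C1_arc_turn[OF dim cont a a] by blast
      from C1_arc_closed[OF this] obtain \<gamma> :: "real \<Rightarrow> 'a" where "arclength_C1_closed_curve \<gamma> l" by blast
      then show ?thesis using True F0 e by (intro exI[of _ \<gamma>]) simp
    qed
    then show ?thesis unfolding N_def by blast
  next
    case False
    then have N: "0 < N" using measure_norm_nonneg[OF F(1)] by (simp add: N_def)
    \<comment> \<open>Ten losses of \<open>\<eta>\<close>: seven in \<open>M\<close>, one more than
      the six that the contradiction has to exceed, two in \<open>C\<close> for rounding the chain,
      and one for padding.\<close>
    define \<eta> where "\<eta> = \<epsilon> / (10 * N)"
    have eta: "0 < \<eta>" using e N by (simp add: \<eta>_def)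
    define M where "M = F \<Phi> / N - 7 * \<eta>"
    obtain d where d: "0 < d" and osc: "\<And>x y. dist x y \<le> d \<Longrightarrow> norm (\<Phi> y - \<Phi> x) \<le> \<eta>"
      using C0_fields_uniform[OF Phi eta] by blast
    have "F \<Phi> = N * (M + 7 * \<eta>)" using N by (simp add: M_def)
    moreover have "N * (M + 6 * \<eta>) < N * (M + 7 * \<eta>)" using N eta by simp
    ultimately have "\<not> F \<Phi> \<le> N * (M + 6 * \<eta>)" by simp
    then have "\<not> (\<forall>x s v. chain \<Phi> d x x s v \<longrightarrow> v \<le> M * s)"
      using functional_le_critical_value[OF F Phi d _ osc eta, of M] unfolding N_def by blast
    then obtain x s v where c: "chain \<Phi> d x x s v" "M * s < v" by (auto simp: not_le)
    have s: "0 < s" using chain_zero[OF c(1)] c(2) by (cases "s = 0") auto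
    \<comment> \<open>Chosen so that the lost integral \<open>\<tau>\<close> and the effect
      \<open>\<bar>M\<bar> * \<tau>\<close> of the excess length add up to
      \<open>\<eta> * s\<close>.\<close>
    define \<tau> where "\<tau> = \<eta> * s / (1 + \<bar>M\<bar>)"
    have t: "0 < \<tau>" using eta s by (simp add: \<tau>_def add_pos_nonneg)
    have t2: "\<tau> + \<bar>M\<bar> * \<tau> = \<eta> * s" by (simp add: \<tau>_def field_simps add_nonneg_eq_0_iff)
    obtain L I where L: "C1_arc \<Phi> x a x a L I" "s \<le> L" "L \<le> s + \<tau>" "v - \<eta> * s - \<tau> \<le> I"
      using chain_arc[OF dim cont B a osc c(1) t] by blast
    define C where "C = M - 2 * \<eta>"
    have "M * (L - s) \<le> \<bar>M\<bar> * \<tau>" using L by (intro mult_mono) auto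
    moreover have "\<eta> * s \<le> \<eta> * L" using L eta by simp
    ultimately have "C * L \<le> I" using L(4) c(2) t2 by (simp add: C_def algebra_simps)
    note pad = C1_arc_pad[OF dim cont B a L(1) this]
    define l0 where "l0 = max L ((\<bar>C\<bar> + B) * L / \<eta>)"
    have Lp: "0 < L" using L s by simp
    have "\<exists>\<gamma>. arclength_C1_closed_curve \<gamma> l \<and> F \<Phi> - \<epsilon> \<le> N * (curve_measure \<gamma> l \<Phi> / l)" if l: "l0 \<le> l" for l
    proof -
      have lL: "L \<le> l" "(\<bar>C\<bar> + B) * L \<le> \<eta> * l"
        using l eta by (auto simp: l0_def pos_divide_le_eq mult.commute)
      then have lp: "0 < l" using Lp by simp
      obtain J where J: "C1_arc \<Phi> x a x a l J" "C * l - (\<bar>C\<bar> + B) * L \<le> J" using pad[OF lL(1)] by blast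
      obtain \<gamma> where g: "arclength_C1_closed_curve \<gamma> l" "curve_measure \<gamma> l \<Phi> = J"
        using C1_arc_closed[OF J(1)] by blast
      have "(C - \<eta>) * l \<le> J" using J(2) lL(2) by (simp add: algebra_simps)
      then have "C - \<eta> \<le> J / l" using lp by (simp add: pos_le_divide_eq)
      then have "N * (C - \<eta>) \<le> N * (J / l)" using N by (intro mult_left_mono) auto
      moreover have "N * (C - \<eta>) = F \<Phi> - \<epsilon>" using N by (simp add: C_def M_def \<eta>_def field_simps)
      ultimately show ?thesis using g by (intro exI[of _ \<gamma>]) simp
    qed
    then show ?thesis unfolding N_def by blast
  qed
qed

subsection \<open>Averages of curves\<close>

lemma C0_fields_sum: "(\<And>j. j \<in> A \<Longrightarrow> \<Phi> j \<in> C0_fields) \<Longrightarrow> (\<lambda>x. \<Sum>j\<in>A. c j *\<^sub>R \<Phi> j x) \<in> C0_fields"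
  by (induction A rule: infinite_finite_induct) (auto simp: C0_fields_zero intro!: C0_fields_add C0_fields_scaleR)

lemma functional_sum:
  assumes F: "vector_radon_measure F"
  shows "finite A \<Longrightarrow> (\<And>j. j \<in> A \<Longrightarrow> \<Phi> j \<in> C0_fields) \<Longrightarrow> F (\<lambda>x. \<Sum>j\<in>A. c j *\<^sub>R \<Phi> j x) = (\<Sum>j\<in>A. c j * F (\<Phi> j))"
proof (induction A rule: finite_induct)
  case empty
  show ?case using functional_scaleR[OF F C0_fields_zero, of 0] by simp
next
  case (insert j A)
  have "F (\<lambda>x. c j *\<^sub>R \<Phi> j x + (\<Sum>j\<in>A. c j *\<^sub>R \<Phi> j x)) = F (\<lambda>x. c j *\<^sub>R \<Phi> j x) + F (\<lambda>x. \<Sum>j\<in>A. c j *\<^sub>R \<Phi> j x)"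
    using insert.prems by (intro functional_add[OF F] C0_fields_scaleR C0_fields_sum) auto
  then show ?case using insert functional_scaleR[OF F, of "\<Phi> j"] by simp
qed

lemma curve_measure_sum:
  assumes g: "arclength_C1_closed_curve \<gamma> L"
  shows "finite A \<Longrightarrow> (\<And>j. j \<in> A \<Longrightarrow> \<Phi> j \<in> C0_fields) \<Longrightarrow>
    curve_measure \<gamma> L (\<lambda>x. \<Sum>j\<in>A. c j *\<^sub>R \<Phi> j x) = (\<Sum>j\<in>A. c j * curve_measure \<gamma> L (\<Phi> j))"
proof (induction A rule: finite_induct)
  case empty
  show ?case by (simp add: curve_measure_def)
next
  case (insert j A)
  have "curve_measure \<gamma> L (\<lambda>x. c j *\<^sub>R \<Phi> j x + (\<Sum>j\<in>A. c j *\<^sub>R \<Phi> j x)) = curve_measure \<gamma> L (\<lambda>x. c j *\<^sub>R \<Phi> j x) + curve_measure \<gamma> L (\<lambda>x. \<Sum>j\<in>A. c j *\<^sub>R \<Phi> j x)"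
    using insert.prems by (intro curve_measure_add[OF g] C0_fieldsD C0_fields_scaleR C0_fields_sum) auto
  then show ?case using insert by (simp add: curve_measure_scaleR)
qed

text \<open>Normalised by length and linear in the field, so that averaging over curves of common
  length \<open>l\<close> gives exactly the defect in the weak-star limit.\<close>

definition curve_error :: "(('a::euclidean_space \<Rightarrow> 'a) \<Rightarrow> real) \<Rightarrow> (real \<Rightarrow> 'a) \<Rightarrow> real \<Rightarrow> ('a \<Rightarrow> 'a) \<Rightarrow> real" where
  "curve_error F \<gamma> l \<Phi> = F \<Phi> - measure_norm F * (curve_measure \<gamma> l \<Phi> / l)"

text \<open>The bound is the same for all curves and lengths. It supplies the constant of the greedy
  choice and later carries convergence from a dense family to all fields.\<close>

lemma curve_error_bound:
  assumes F: "vector_radon_measure F" and g: "arclength_C1_closed_curve \<gamma> l"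
    and Phi: "\<Phi> \<in> C0_fields" and B: "\<And>x. norm (\<Phi> x) \<le> B"
  shows "\<bar>curve_error F \<gamma> l \<Phi>\<bar> \<le> 2 * measure_norm F * B"
proof -
  have l: "0 < l" using g by (simp add: arclength_C1_closed_curve_def)
  have N: "0 \<le> measure_norm F" using measure_norm_nonneg[OF F] .
  have "\<bar>curve_measure \<gamma> l \<Phi> / l\<bar> \<le> B"
    using curve_measure_bound[OF g C0_fieldsD[OF Phi] B] l by (simp add: abs_divide pos_divide_le_eq)
  then have "\<bar>measure_norm F * (curve_measure \<gamma> l \<Phi> / l)\<bar> \<le> measure_norm F * B"
    using mult_left_mono[OF _ N] N by (simp only: abs_mult abs_of_nonneg)
  moreover have "\<bar>F \<Phi>\<bar> \<le> measure_norm F * B"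
    using measure_norm_bound[OF F Phi] mult_left_mono[OF sup_norm_le[of \<Phi> B, OF B] N] by linarith
  ultimately show ?thesis unfolding curve_error_def by linarith
qed

lemma curve_error_sum:
  assumes F: "vector_radon_measure F" and g: "arclength_C1_closed_curve \<gamma> l"
    and "finite A" "\<And>j. j \<in> A \<Longrightarrow> \<Phi> j \<in> C0_fields"
  shows "curve_error F \<gamma> l (\<lambda>x. \<Sum>j\<in>A. c j *\<^sub>R \<Phi> j x) = (\<Sum>j\<in>A. c j * curve_error F \<gamma> l (\<Phi> j))"
proof -
  have "F (\<lambda>x. \<Sum>j\<in>A. c j *\<^sub>R \<Phi> j x) = (\<Sum>j\<in>A. c j * F (\<Phi> j))"
    using assms(4) by (rule functional_sum[OF F assms(3)])
  moreover have "curve_measure \<gamma> l (\<lambda>x. \<Sum>j\<in>A. c j *\<^sub>R \<Phi> j x) = (\<Sum>j\<in>A. c j * curve_measure \<gamma> l (\<Phi> j))"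
    using assms(4) by (rule curve_measure_sum[OF g assms(3)])
  ultimately show ?thesis unfolding curve_error_def
    by (simp add: right_diff_distrib sum_subtractf sum_divide_distrib sum_distrib_left mult_ac)
qed

text \<open>The threshold length of \<open>closed_curve_near_critical\<close> depends on the field.
  Rounding the coefficients to multiples of \<open>\<eta>\<close> leaves finitely many combinations,
  whose thresholds have a common bound.\<close>

lemma curve_error_uniform:
  fixes F :: "('a::euclidean_space \<Rightarrow> 'a) \<Rightarrow> real" and \<Phi> :: "nat \<Rightarrow> 'a \<Rightarrow> 'a"
  assumes dim: "DIM('a) \<ge> 2" and F: "vector_radon_measure F" "div_free F"
    and Phi: "\<And>j. j < k \<Longrightarrow> \<Phi> j \<in> C0_fields"
    and D: "\<And>j \<gamma> l. j < k \<Longrightarrow> arclength_C1_closed_curve \<gamma> l \<Longrightarrow> \<bar>curve_error F \<gamma> l (\<Phi> j)\<bar> \<le> D" and D0: "0 < D"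
    and e: "0 < \<epsilon>"
  shows "\<forall>\<^sub>F l in at_top. \<forall>c. (\<forall>j<k. \<bar>c j\<bar> \<le> C) \<longrightarrow>
    (\<exists>\<gamma>. arclength_C1_closed_curve \<gamma> l \<and> (\<Sum>j<k. c j * curve_error F \<gamma> l (\<Phi> j)) \<le> \<epsilon>)"
proof -
  \<comment> \<open>Rounding \<open>k\<close> coefficients costs at most
    \<open>k * \<eta> * D\<close>, which is to stay below \<open>\<epsilon> / 2\<close>;
    \<open>k + 1\<close> keeps the denominator positive.\<close>
  define \<eta> where "\<eta> = \<epsilon> / (2 * (real k + 1) * D)"
  have eta: "0 < \<eta>" using e D0 by (simp add: \<eta>_def add_pos_nonneg)
  have "\<eta> * (2 * (real k + 1) * D) = \<epsilon>" using D0 by (simp add: \<eta>_def add_nonneg_eq_0_iff)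
  moreover have "0 < \<eta> * D" using eta D0 by simp
  ultimately have eta2: "real k * (\<eta> * D) \<le> \<epsilon> / 2" by (simp add: algebra_simps)
  define m where "m = \<lceil>C / \<eta>\<rceil> + 1"
  define G where "G = PiE {..<k} (\<lambda>_. {-m..m})"
  have fin: "finite G" unfolding G_def by (intro finite_PiE) auto
  have "\<forall>\<^sub>F l in at_top. \<forall>g\<in>G. \<exists>\<gamma>. arclength_C1_closed_curve \<gamma> l \<and> (\<Sum>j<k. (\<eta> * of_int (g j)) * curve_error F \<gamma> l (\<Phi> j)) \<le> \<epsilon> / 2"
  proof (rule eventually_ball_finite[OF fin], rule ballI)
    fix g :: "nat \<Rightarrow> int" assume "g \<in> G"
    let ?\<Psi> = "\<lambda>x. \<Sum>j<k. (\<eta> * of_int (g j)) *\<^sub>R \<Phi> j x"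
    have "?\<Psi> \<in> C0_fields" using Phi by (intro C0_fields_sum) simp
    moreover have "0 < \<epsilon> / 2" using e by simp
    ultimately obtain l0 where l0: "\<forall>l\<ge>l0. \<exists>\<gamma>. arclength_C1_closed_curve \<gamma> l \<and>
       F ?\<Psi> - \<epsilon> / 2 \<le> measure_norm F * (curve_measure \<gamma> l ?\<Psi> / l)"
      using closed_curve_near_critical[OF dim F] by blast
    show "\<forall>\<^sub>F l in at_top. \<exists>\<gamma>. arclength_C1_closed_curve \<gamma> l \<and> (\<Sum>j<k. (\<eta> * of_int (g j)) * curve_error F \<gamma> l (\<Phi> j)) \<le> \<epsilon> / 2"
      using eventually_ge_at_top[of l0]
    proof eventually_elim
      fix l assume "l0 \<le> l"
      then obtain \<gamma> where g: "arclength_C1_closed_curve \<gamma> l"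
        "F ?\<Psi> - \<epsilon> / 2 \<le> measure_norm F * (curve_measure \<gamma> l ?\<Psi> / l)" using l0 by blast
      have "curve_error F \<gamma> l ?\<Psi> \<le> \<epsilon> / 2" using g(2) unfolding curve_error_def by linarith
      then show "\<exists>\<gamma>. arclength_C1_closed_curve \<gamma> l \<and> (\<Sum>j<k. (\<eta> * of_int (g j)) * curve_error F \<gamma> l (\<Phi> j)) \<le> \<epsilon> / 2"
        using g(1) curve_error_sum[OF F(1) g(1), of "{..<k}" \<Phi>] Phi by (intro exI[of _ \<gamma>]) simp
    qed
  qed
  then show ?thesis
  proof (rule eventually_mono, intro allI impI)
    fix l :: real and c :: "nat \<Rightarrow> real"
    assume net: "\<forall>g\<in>G. \<exists>\<gamma>. arclength_C1_closed_curve \<gamma> l \<and> (\<Sum>j<k. (\<eta> * of_int (g j)) * curve_error F \<gamma> l (\<Phi> j)) \<le> \<epsilon> / 2"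
      and c: "\<forall>j<k. \<bar>c j\<bar> \<le> C"
    define g where "g = (\<lambda>j\<in>{..<k}. \<lfloor>c j / \<eta>\<rfloor>)"
    have "g \<in> G" unfolding G_def
    proof (rule PiE_I)
      fix j assume j: "j \<in> {..<k}"
      then have "\<bar>c j / \<eta>\<bar> \<le> C / \<eta>" using c eta by (simp add: divide_right_mono)
      then have "- (C / \<eta>) \<le> c j / \<eta>" "c j / \<eta> \<le> C / \<eta>" by linarith+
      then show "g j \<in> {-m..m}" using j unfolding g_def m_def by (simp, linarith)
    qed (simp add: g_def)
    then obtain \<gamma> where \<gamma>: "arclength_C1_closed_curve \<gamma> l" "(\<Sum>j<k. (\<eta> * of_int (g j)) * curve_error F \<gamma> l (\<Phi> j)) \<le> \<epsilon> / 2"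
      using net by blast
    have "c j * curve_error F \<gamma> l (\<Phi> j) \<le> (\<eta> * of_int (g j)) * curve_error F \<gamma> l (\<Phi> j) + \<eta> * D" if j: "j < k" for j
    proof -
      have "of_int (g j) \<le> c j / \<eta>" "c j / \<eta> < of_int (g j) + 1" using j by (simp_all add: g_def)
      then have "\<bar>c j - \<eta> * of_int (g j)\<bar> \<le> \<eta>"
        using eta by (simp add: pos_le_divide_eq pos_divide_less_eq abs_le_iff algebra_simps)
      then have "\<bar>(c j - \<eta> * of_int (g j)) * curve_error F \<gamma> l (\<Phi> j)\<bar> \<le> \<eta> * D"
        unfolding abs_mult using D[OF j \<gamma>(1)] eta by (intro mult_mono) auto
      then show ?thesis by (simp add: left_diff_distrib)
    qed
    then have "(\<Sum>j<k. c j * curve_error F \<gamma> l (\<Phi> j)) \<le> (\<Sum>j<k. (\<eta> * of_int (g j)) * curve_error F \<gamma> l (\<Phi> j) + \<eta> * D)"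
      by (intro sum_mono) simp
    also have "\<dots> \<le> \<epsilon>" using \<gamma>(2) eta2 by (simp add: sum.distrib)
    finally show "\<exists>\<gamma>. arclength_C1_closed_curve \<gamma> l \<and> (\<Sum>j<k. c j * curve_error F \<gamma> l (\<Phi> j)) \<le> \<epsilon>"
      using \<gamma>(1) by blast
  qed
qed

text \<open>Greedy choice in place of Hahn--Banach: each new curve has error vector nearly pointing
  against the accumulated one, so the accumulated error grows like \<open>n \<surd>\<epsilon> + \<surd>n\<close>.\<close>
lemma greedy_average:
  fixes E :: "'c \<Rightarrow> nat \<Rightarrow> real"
  assumes D: "\<And>g j. P g \<Longrightarrow> j < k \<Longrightarrow> \<bar>E g j\<bar> \<le> D"
    and step: "\<And>c. (\<forall>j<k. \<bar>c j\<bar> \<le> D) \<Longrightarrow> \<exists>g. P g \<and> (\<Sum>j<k. c j * E g j) \<le> \<epsilon>" and D0: "0 \<le> D"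
  shows "\<exists>g. (\<forall>i<n. P (g i)) \<and> (\<Sum>j<k. (\<Sum>i<n. E (g i) j)\<^sup>2) \<le> (real n)\<^sup>2 * \<epsilon> + real n * (real k * D\<^sup>2)"
proof (induction n)
  case 0
  show ?case by simp
next
  case (Suc n)
  then obtain g where g: "\<forall>i<n. P (g i)"
    "(\<Sum>j<k. (\<Sum>i<n. E (g i) j)\<^sup>2) \<le> (real n)\<^sup>2 * \<epsilon> + real n * (real k * D\<^sup>2)" by blast
  define S where "S j = (\<Sum>i<n. E (g i) j)" for j
  have S: "\<bar>S j\<bar> \<le> real n * D" if "j < k" for j
  proof -
    have "\<bar>S j\<bar> \<le> (\<Sum>i<n. \<bar>E (g i) j\<bar>)" unfolding S_def by (rule sum_abs)
    also have "\<dots> \<le> (\<Sum>i<n. D)" using g(1) D that by (intro sum_mono) auto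
    finally show ?thesis by simp
  qed
  have "\<exists>h. P h \<and> (\<Sum>j<k. S j * E h j) \<le> real n * \<epsilon>"
  proof (cases "n = 0")
    case True
    then show ?thesis using step[of "\<lambda>_. 0"] D0 by (auto simp: S_def)
  next
    case False
    \<comment> \<open>Division by \<open>n\<close> brings the accumulated errors into the
      coefficient range of \<open>step\<close>.\<close>
    have "\<bar>S j / real n\<bar> \<le> D" if "j < k" for j
      using S[OF that] False by (simp add: abs_divide pos_divide_le_eq mult.commute)
    then obtain h where h: "P h" "(\<Sum>j<k. S j / real n * E h j) \<le> \<epsilon>" using step[of "\<lambda>j. S j / real n"] by blast
    have "(\<Sum>j<k. S j * E h j) = real n * (\<Sum>j<k. S j / real n * E h j)"
      using False by (simp add: sum_distrib_left)
    also have "\<dots> \<le> real n * \<epsilon>" using h(2) by (intro mult_left_mono) auto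
    finally show ?thesis using h(1) by blast
  qed
  then obtain h where h: "P h" "(\<Sum>j<k. S j * E h j) \<le> real n * \<epsilon>" by blast
  \<comment> \<open>Zero coefficients show \<open>0 \<le> \<epsilon>\<close>, which absorbs the
    cross term \<open>2 * n * \<epsilon>\<close> into the square of \<open>Suc n\<close>.\<close>
  have "\<exists>h. P h \<and> (\<Sum>j<k. 0 * E h j) \<le> \<epsilon>" using D0 by (intro step) simp
  then have eps0: "0 \<le> \<epsilon>" by simp
  have "(\<Sum>j<k. (E h j)\<^sup>2) \<le> (\<Sum>j<k. D\<^sup>2)"
    using D[OF h(1)] D0 by (intro sum_mono abs_le_square_iff[THEN iffD1]) auto
  then have 1: "(\<Sum>j<k. (E h j)\<^sup>2) \<le> real k * D\<^sup>2" by simp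
  have "(\<Sum>j<k. (\<Sum>i<Suc n. E ((g(n := h)) i) j)\<^sup>2) = (\<Sum>j<k. (S j + E h j)\<^sup>2)"
    by (simp add: S_def)
  also have "\<dots> = (\<Sum>j<k. (S j)\<^sup>2) + 2 * (\<Sum>j<k. S j * E h j) + (\<Sum>j<k. (E h j)\<^sup>2)"
    by (simp add: power2_sum sum.distrib sum_distrib_left mult_ac)
  also have "\<dots> \<le> ((real n)\<^sup>2 * \<epsilon> + real n * (real k * D\<^sup>2)) + 2 * (real n * \<epsilon>) + real k * D\<^sup>2"
    using g(2) h(2) 1 unfolding S_def by linarith
  also have "\<dots> \<le> (real (Suc n))\<^sup>2 * \<epsilon> + real (Suc n) * (real k * D\<^sup>2)"
    using eps0 by (simp add: power2_eq_square algebra_simps)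
  finally show ?case using g(1) h(1) by (intro exI[of _ "g(n := h)"]) (auto simp: less_Suc_eq)
qed

lemma finite_family_approx:
  fixes F :: "('a::euclidean_space \<Rightarrow> 'a) \<Rightarrow> real" and \<Phi> :: "nat \<Rightarrow> 'a \<Rightarrow> 'a"
  assumes dim: "DIM('a) \<ge> 2" and F: "vector_radon_measure F" "div_free F"
    and Phi: "\<And>j. j < k \<Longrightarrow> \<Phi> j \<in> C0_fields" and e: "0 < e"
  shows "\<forall>\<^sub>F l in at_top. \<exists>n \<gamma>. 0 < n \<and> (\<forall>i<n. arclength_C1_closed_curve (\<gamma> i) l) \<and>
    (\<forall>j<k. \<bar>(\<Sum>i<n. curve_error F (\<gamma> i) l (\<Phi> j)) / real n\<bar> \<le> e)"
proof -
  define D where "D = 1 + 2 * measure_norm F * (\<Sum>j<k. sup_norm (\<Phi> j))"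
  have N: "0 \<le> measure_norm F" using measure_norm_nonneg[OF F(1)] .
  have s0: "0 \<le> sup_norm (\<Phi> j)" if "j < k" for j using sup_norm_nonneg[OF Phi[OF that]] .
  then have "0 \<le> (\<Sum>j<k. sup_norm (\<Phi> j))" by (intro sum_nonneg) auto
  then have D0: "0 < D" using N unfolding D_def by (intro add_pos_nonneg mult_nonneg_nonneg) auto
  have D: "\<bar>curve_error F \<gamma> l (\<Phi> j)\<bar> \<le> D" if "j < k" "arclength_C1_closed_curve \<gamma> l" for j \<gamma> l
  proof -
    have "\<bar>curve_error F \<gamma> l (\<Phi> j)\<bar> \<le> 2 * measure_norm F * sup_norm (\<Phi> j)"
      using curve_error_bound[OF F(1) that(2) Phi[OF that(1)] norm_le_sup_norm[OF Phi[OF that(1)]]] .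
    also have "\<dots> \<le> 2 * measure_norm F * (\<Sum>j<k. sup_norm (\<Phi> j))"
      using N s0 that(1) by (intro mult_left_mono member_le_sum) auto
    finally show ?thesis unfolding D_def by linarith
  qed
  \<comment> \<open>Both terms of the greedy bound become at most half of the square of
    \<open>n * e\<close>: the first by this choice, the second because \<open>n\<close> is taken
    large. The number \<open>n\<close> is fixed before \<open>l\<close>.\<close>
  define \<epsilon> where "\<epsilon> = e\<^sup>2 / 2"
  have eps: "0 < \<epsilon>" using e by (simp add: \<epsilon>_def)
  obtain n where "real k * D\<^sup>2 / \<epsilon> < real n" using reals_Archimedean2 by blast
  moreover have "0 \<le> real k * D\<^sup>2 / \<epsilon>" using eps by simp
  ultimately have n: "0 < real n" "real k * D\<^sup>2 \<le> real n * \<epsilon>"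
    using eps by (linarith, simp add: pos_divide_less_eq)
  from curve_error_uniform[OF dim F Phi D D0 eps, where C = D] show ?thesis
  proof (rule eventually_mono)
    fix l :: real
    assume U: "\<forall>c. (\<forall>j<k. \<bar>c j\<bar> \<le> D) \<longrightarrow>
       (\<exists>\<gamma>. arclength_C1_closed_curve \<gamma> l \<and> (\<Sum>j<k. c j * curve_error F \<gamma> l (\<Phi> j)) \<le> \<epsilon>)"
    have "\<exists>\<gamma>. (\<forall>i<n. arclength_C1_closed_curve (\<gamma> i) l) \<and>
       (\<Sum>j<k. (\<Sum>i<n. curve_error F (\<gamma> i) l (\<Phi> j))\<^sup>2) \<le> (real n)\<^sup>2 * \<epsilon> + real n * (real k * D\<^sup>2)"
      by (rule greedy_average[where E = "\<lambda>\<gamma> j. curve_error F \<gamma> l (\<Phi> j)"]) (use D U D0 in auto)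
    then obtain \<gamma> where g: "\<forall>i<n. arclength_C1_closed_curve (\<gamma> i) l"
      and S: "(\<Sum>j<k. (\<Sum>i<n. curve_error F (\<gamma> i) l (\<Phi> j))\<^sup>2) \<le> (real n)\<^sup>2 * \<epsilon> + real n * (real k * D\<^sup>2)" by blast
    have "\<bar>(\<Sum>i<n. curve_error F (\<gamma> i) l (\<Phi> j)) / real n\<bar> \<le> e" if j: "j < k" for j
    proof -
      let ?S = "\<Sum>i<n. curve_error F (\<gamma> i) l (\<Phi> j)"
      have "?S\<^sup>2 \<le> (\<Sum>j<k. (\<Sum>i<n. curve_error F (\<gamma> i) l (\<Phi> j))\<^sup>2)"
        using j by (intro member_le_sum) auto
      also note S
      also have "(real n)\<^sup>2 * \<epsilon> + real n * (real k * D\<^sup>2) \<le> (real n)\<^sup>2 * \<epsilon> + real n * (real n * \<epsilon>)"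
        using n by (intro add_left_mono mult_left_mono) auto
      also have "\<dots> = (real n * e)\<^sup>2" by (simp add: \<epsilon>_def power2_eq_square)
      finally have "\<bar>?S\<bar> \<le> \<bar>real n * e\<bar>" by (simp only: abs_le_square_iff)
      then show ?thesis using n(1) e by (simp add: abs_divide pos_divide_le_eq abs_mult mult.commute)
    qed
    then show "\<exists>n \<gamma>. 0 < n \<and> (\<forall>i<n. arclength_C1_closed_curve (\<gamma> i) l) \<and>
       (\<forall>j<k. \<bar>(\<Sum>i<n. curve_error F (\<gamma> i) l (\<Phi> j)) / real n\<bar> \<le> e)"
      using g n(1) by (intro exI[of _ n] exI[of _ \<gamma>]) auto
  qed
qed


section \<open>Dense family, diagonal choice and the limit\<close>

lemma curve_error_sum_eq:
  assumes "0 < n"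
  shows "(\<Sum>i<n. curve_error F (\<gamma> i) l \<Phi>) / real n
    = F \<Phi> - measure_norm F / (real n * l) * (\<Sum>i<n. curve_measure (\<gamma> i) l \<Phi>)"
proof -
  have "(\<Sum>i<n. curve_error F (\<gamma> i) l \<Phi>) = real n * F \<Phi> - measure_norm F / l * (\<Sum>i<n. curve_measure (\<gamma> i) l \<Phi>)"
    by (simp add: curve_error_def sum_subtractf sum_distrib_left)
  then show ?thesis using assms by (simp add: diff_divide_distrib mult.commute)
qed

lemma curve_error_diff:
  assumes F: "vector_radon_measure F" and g: "arclength_C1_closed_curve \<gamma> l"
    and "\<Phi> \<in> C0_fields" "\<Psi> \<in> C0_fields"
  shows "curve_error F \<gamma> l \<Phi> - curve_error F \<gamma> l \<Psi> = curve_error F \<gamma> l (\<lambda>x. \<Phi> x - \<Psi> x)"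
proof -
  have "curve_measure \<gamma> l (\<lambda>x. (\<Phi> x - \<Psi> x) + \<Psi> x) = curve_measure \<gamma> l (\<lambda>x. \<Phi> x - \<Psi> x) + curve_measure \<gamma> l \<Psi>"
    using assms by (intro curve_measure_add[OF g] C0_fieldsD C0_fields_diff)
  then have "curve_measure \<gamma> l (\<lambda>x. \<Phi> x - \<Psi> x) = curve_measure \<gamma> l \<Phi> - curve_measure \<gamma> l \<Psi>" by simp
  then show ?thesis
    unfolding curve_error_def functional_diff[OF F assms(3,4)]
    by (simp add: diff_divide_distrib right_diff_distrib)
qed

text \<open>A field in \<open>C0_fields\<close> is determined up to a small error by its approximate values on a
  finite net of a large ball; these values can be taken in a countable dense set.\<close>
lemma C0_fields_separable:
  obtains \<Phi> :: "nat \<Rightarrow> 'a::euclidean_space \<Rightarrow> 'a" where "\<And>j. \<Phi> j \<in> C0_fields"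
    "\<And>\<Psi> e. \<Psi> \<in> C0_fields \<Longrightarrow> 0 < e \<Longrightarrow> \<exists>j. \<forall>x. norm (\<Psi> x - \<Phi> j x) \<le> e"
proof -
  obtain Q :: "'a set" where Q: "countable Q" "\<And>X. open X \<Longrightarrow> X \<noteq> {} \<Longrightarrow> \<exists>q\<in>Q. q \<in> X"
    using countable_dense_exists by metis
  have "\<exists>ps. \<forall>x\<in>cball (0::'a) (real n). \<exists>p\<in>set ps. dist x p \<le> 1 / real (Suc n)" for n
  proof -
    have "0 < 1 / real (Suc n)" by simp
    then obtain k where k: "finite k" "cball (0::'a) (real n) \<subseteq> (\<Union>p\<in>k. ball p (1 / real (Suc n)))"
      using compact_cball[of "0::'a" "real n"] unfolding compact_eq_totally_bounded by blast
    from finite_list[OF k(1)] obtain ps where "set ps = k" by blast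
    then show ?thesis using k(2) by (intro exI[of _ ps]) (force simp: dist_commute)
  qed
  then have "\<exists>net. \<forall>n. \<forall>x\<in>cball (0::'a) (real n). \<exists>p\<in>set (net n). dist x p \<le> 1 / real (Suc n)"
    by (intro choice allI)
  then obtain net :: "nat \<Rightarrow> 'a list"
    where "\<forall>n. \<forall>x\<in>cball (0::'a) (real n). \<exists>p\<in>set (net n). dist x p \<le> 1 / real (Suc n)" by (elim exE)
  then have net: "\<exists>p\<in>set (net n). dist x p \<le> 1 / real (Suc n)" if "norm x \<le> real n" for n x
    using that by simp
  \<comment> \<open>In a code, \<open>m\<close> is the precision, while the one index
    \<open>n\<close> serves as radius beyond which the field is small, as modulus of continuity and
    as fineness of the net; \<open>qs\<close> holds the approximate values on the net.\<close>
  define ok where "ok = (\<lambda>(m::nat, n::nat, qs::'a list) \<Phi>. \<Phi> \<in> C0_fields \<and>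
      (\<forall>x y. dist x y \<le> 1 / real (Suc n) \<longrightarrow> norm (\<Phi> y - \<Phi> x) \<le> 1 / real (Suc m)) \<and>
      (\<forall>x. real n \<le> norm x \<longrightarrow> norm (\<Phi> x) \<le> 1 / real (Suc m)) \<and>
      list_all2 (\<lambda>p q. norm (\<Phi> p - q) \<le> 1 / real (Suc m)) (net n) qs)"
  \<comment> \<open>The factor 4 counts two approximations at a net point and two oscillations from
    there to \<open>x\<close>.\<close>
  have close: "norm (\<Psi> x - \<Phi> x) \<le> 4 / real (Suc m)" if "ok (m, n, qs) \<Phi>" "ok (m, n, qs) \<Psi>" for m n qs \<Phi> \<Psi> and x :: 'a
  proof -
    let ?e = "1 / real (Suc m)"
    have e: "4 / real (Suc m) = 4 * ?e" "0 < ?e" by simp_all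
    show ?thesis
    proof (cases "norm x \<le> real n")
      case True
      then obtain p where p: "p \<in> set (net n)" "dist x p \<le> 1 / real (Suc n)" using net by blast
      then obtain i where i: "i < length (net n)" "net n ! i = p" by (auto simp: in_set_conv_nth)
      have "norm (\<Phi> p - qs ! i) \<le> ?e" "norm (\<Psi> p - qs ! i) \<le> ?e"
        using that i by (auto simp: ok_def list_all2_conv_all_nth)
      moreover have "norm (\<Phi> p - \<Phi> x) \<le> ?e" "norm (\<Psi> p - \<Psi> x) \<le> ?e"
        using that p(2) by (auto simp: ok_def)
      moreover have "norm (\<Psi> x - \<Phi> x)
        \<le> norm (\<Psi> p - qs ! i) + norm (\<Phi> p - qs ! i) + norm (\<Psi> p - \<Psi> x) + norm (\<Phi> p - \<Phi> x)"
      proof -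
        have "\<Psi> x - \<Phi> x = (\<Psi> p - qs ! i) - (\<Phi> p - qs ! i) - (\<Psi> p - \<Psi> x) + (\<Phi> p - \<Phi> x)" by simp
        also have "norm \<dots> \<le> norm (\<Psi> p - qs ! i) + norm (\<Phi> p - qs ! i) + norm (\<Psi> p - \<Psi> x) + norm (\<Phi> p - \<Phi> x)"
          by (intro norm_triangle_mono norm_triangle_le_diff add_mono order_refl)
        finally show ?thesis .
      qed
      ultimately show ?thesis unfolding e(1) by linarith
    next
      case False
      then have "norm (\<Phi> x) \<le> ?e" "norm (\<Psi> x) \<le> ?e" using that by (auto simp: ok_def)
      then show ?thesis using norm_triangle_ineq4[of "\<Psi> x" "\<Phi> x"] e by linarith
    qed
  qed
  have ex: "\<exists>n qs. set qs \<subseteq> Q \<and> ok (m, n, qs) \<Psi>" if Psi: "\<Psi> \<in> C0_fields" for m \<Psi>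
  proof -
    let ?e = "1 / real (Suc m)"
    have e: "0 < ?e" by simp
    obtain R where R: "\<And>x. R \<le> norm x \<Longrightarrow> norm (\<Psi> x) < ?e" using C0_fields_small[OF Psi e] by metis
    obtain d where d: "0 < d" "\<And>x y. dist x y \<le> d \<Longrightarrow> norm (\<Psi> y - \<Psi> x) \<le> ?e" using C0_fields_uniform[OF Psi e] by metis
    obtain n where n: "max R (1 / d) \<le> real n" using real_arch_simple by blast
    have "1 / d \<le> real (Suc n)" using n by simp
    then have nd: "1 / real (Suc n) \<le> d" using d(1) by (simp add: divide_simps mult.commute)
    have "\<exists>q\<in>Q. norm (\<Psi> p - q) \<le> ?e" for p
    proof -
      have "ball (\<Psi> p) ?e \<noteq> {}" using e by simp
      then obtain q where "q \<in> Q" "q \<in> ball (\<Psi> p) ?e" using Q(2)[OF open_ball] by blast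
      then show ?thesis by (intro bexI[of _ q]) (simp_all add: dist_norm)
    qed
    then obtain q where q: "\<And>p. q p \<in> Q" "\<And>p. norm (\<Psi> p - q p) \<le> ?e" by metis
    have "ok (m, n, map q (net n)) \<Psi>"
      unfolding ok_def using Psi d(2) nd R n q(2) by (auto simp: list_all2_conv_all_nth less_imp_le)
    moreover have "set (map q (net n)) \<subseteq> Q" using q(1) by auto
    ultimately show ?thesis by blast
  qed
  \<comment> \<open>Only codes realised by some field are enumerated, so a representative can be
    chosen for each; by \<open>close\<close> it stands for all fields with that code.\<close>
  define C where "C = {c \<in> UNIV \<times> UNIV \<times> lists Q. \<exists>\<Psi>. ok c \<Psi>}"
  have "countable C"
    unfolding C_def by (rule countable_subset[of _ "UNIV \<times> UNIV \<times> lists Q"]) (use Q(1) in auto)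
  moreover have "C \<noteq> {}" using ex[OF C0_fields_zero, of 0] unfolding C_def by (auto simp: subset_iff)
  ultimately have rng: "range (from_nat_into C) = C" by (rule range_from_nat_into[rotated])
  define \<Phi> where "\<Phi> j = (SOME \<Psi>. ok (from_nat_into C j) \<Psi>)" for j
  have ok: "ok (from_nat_into C j) (\<Phi> j)" for j
  proof -
    have "from_nat_into C j \<in> C" using rng by blast
    then have "\<exists>\<Psi>. ok (from_nat_into C j) \<Psi>" unfolding C_def by blast
    then show ?thesis unfolding \<Phi>_def by (rule someI_ex)
  qed
  show ?thesis
  proof (rule that)
    show "\<Phi> j \<in> C0_fields" for j using ok[of j] unfolding ok_def by (auto split: prod.splits)
    fix \<Psi> :: "'a \<Rightarrow> 'a" and e :: real assume Psi: "\<Psi> \<in> C0_fields" and e: "0 < e"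
    obtain m where "4 / e < real m" using reals_Archimedean2 by blast
    then have m: "4 / real (Suc m) \<le> e" using e by (simp add: divide_simps mult.commute) (simp add: algebra_simps)
    obtain n qs where c: "set qs \<subseteq> Q" "ok (m, n, qs) \<Psi>" using ex[OF Psi] by blast
    then have "(m, n, qs) \<in> C" unfolding C_def by auto
    then obtain j where "from_nat_into C j = (m, n, qs)" using rng by (metis imageE)
    then have "norm (\<Psi> x - \<Phi> j x) \<le> e" for x using close[OF _ c(2), of "\<Phi> j" x] ok[of j] m by fastforce
    then show "\<exists>j. \<forall>x. norm (\<Psi> x - \<Phi> j x) \<le> e" by blast
  qed
qed

theorem theorem1p4:
  fixes F :: "('a::euclidean_space \<Rightarrow> 'a) \<Rightarrow> real"
  assumes "DIM('a) \<ge> 2"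
    and "vector_radon_measure F"
    and "div_free F"
  shows "\<exists>(n::nat \<Rightarrow> nat) (\<gamma>::nat \<Rightarrow> nat \<Rightarrow> real \<Rightarrow> 'a) (L::nat \<Rightarrow> nat \<Rightarrow> real).
     (\<forall>l\<ge>1. n l > 0 \<and>
        (\<forall>i\<in>{1..n l}. real l \<le> L i l \<and> L i l \<le> 2 * real l \<and>
                        arclength_C1_closed_curve (\<gamma> i l) (L i l))) \<and>
     (\<forall>\<Phi>\<in>C0_fields.
        (\<lambda>l. measure_norm F / (real (n l) * real l) *
              (\<Sum>i=1..n l. curve_measure (\<gamma> i l) (L i l) \<Phi>)) \<longlonglongrightarrow> F \<Phi>) \<and>
     ((\<lambda>l. (\<Sum>i=1..n l. L i l) / (real (n l) * real l)) \<longlonglongrightarrow> 1)"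
proof -
  note F = assms(2,3)
  have N: "0 \<le> measure_norm F" using measure_norm_nonneg[OF F(1)] .
  obtain \<Phi> :: "nat \<Rightarrow> 'a \<Rightarrow> 'a" where Phi: "\<And>j. \<Phi> j \<in> C0_fields"
    and dense: "\<And>\<Psi> e. \<Psi> \<in> C0_fields \<Longrightarrow> 0 < e \<Longrightarrow> \<exists>j. \<forall>x. norm (\<Psi> x - \<Phi> j x) \<le> e"
    using C0_fields_separable by blast
  \<comment> \<open>The index \<open>m\<close> is at once the number of dense fields under control
    and the precision of that control.\<close>
  define P where "P m l n \<gamma> \<longleftrightarrow> 0 < n \<and> (\<forall>i<n. arclength_C1_closed_curve (\<gamma> i) (real l)) \<and>
    (\<forall>j<m. \<bar>(\<Sum>i<n. curve_error F (\<gamma> i) (real l) (\<Phi> j)) / real n\<bar> \<le> 1 / real (Suc m))"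
    for m l n :: nat and \<gamma> :: "nat \<Rightarrow> real \<Rightarrow> 'a"
  \<comment> \<open>With no fields to control, any closed curve qualifies. This provides curves for
    every \<open>l \<ge> 1\<close>, including lengths too short for any approximation.\<close>
  have P0: "\<exists>n \<gamma>. P 0 l n \<gamma>" if "1 \<le> l" for l
  proof -
    obtain a :: 'a where "a \<in> Basis" using nonempty_Basis by blast
    then have a: "norm a = 1" by simp
    have "0 < real l" using that by simp
    then obtain I where "C1_arc (\<Phi> 0) 0 a 0 a (real l) I"
      using C1_arc_turn[OF assms(1) C0_fieldsD[OF Phi] a a] by blast
    from C1_arc_closed[OF this] obtain \<gamma> :: "real \<Rightarrow> 'a" where "arclength_C1_closed_curve \<gamma> (real l)" by blast
    then show ?thesis unfolding P_def by (intro exI[of _ 1] exI[of _ "\<lambda>_. \<gamma>"]) simp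
  qed
  have Pev: "\<forall>\<^sub>F l in sequentially. \<exists>n \<gamma>. P m l n \<gamma>" for m
  proof -
    have "\<forall>\<^sub>F l in at_top. \<exists>n \<gamma>. 0 < n \<and> (\<forall>i<n. arclength_C1_closed_curve (\<gamma> i) l) \<and>
      (\<forall>j<m. \<bar>(\<Sum>i<n. curve_error F (\<gamma> i) l (\<Phi> j)) / real n\<bar> \<le> 1 / real (Suc m))"
      by (rule finite_family_approx[OF assms(1) F Phi]) simp
    then show ?thesis
      unfolding P_def using filterlim_real_sequentially unfolding filterlim_iff by blast
  qed
  \<comment> \<open>The diagonal choice: \<open>\<mu> l\<close> is the best level attainable at
    length \<open>l\<close>. The cap \<open>m \<le> l\<close> makes the maximum exist, and
    \<open>\<mu>\<close> tends to infinity because each level is attainable at all large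
    lengths.\<close>
  define A where "A l = {m. m \<le> l \<and> (\<exists>n \<gamma>. P m l n \<gamma>)}" for l
  define \<mu> where "\<mu> l = Max (A l)" for l
  have finA: "finite (A l)" for l unfolding A_def by (rule finite_subset[of _ "{..l}"]) auto
  have muA: "\<mu> l \<in> A l" if "1 \<le> l" for l
    unfolding \<mu>_def using P0[OF that] by (intro Max_in finA) (auto simp: A_def)
  have mu_ge: "\<forall>\<^sub>F l in sequentially. m \<le> \<mu> l" for m
    using Pev[of m] eventually_ge_at_top[of m]
  proof eventually_elim
    case (elim l)
    then show ?case unfolding \<mu>_def by (intro Max_ge finA) (auto simp: A_def)
  qed
  have "\<forall>l. \<exists>n \<gamma>. 1 \<le> l \<longrightarrow> P (\<mu> l) l n \<gamma>" using muA unfolding A_def by blast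
  then obtain n \<gamma> where P: "\<And>l. 1 \<le> l \<Longrightarrow> P (\<mu> l) l (n l) (\<gamma> l)" by metis
  have n: "0 < n l" and g: "\<And>i. i < n l \<Longrightarrow> arclength_C1_closed_curve (\<gamma> l i) (real l)"
    and err: "\<And>j. j < \<mu> l \<Longrightarrow> \<bar>(\<Sum>i<n l. curve_error F (\<gamma> l i) (real l) (\<Phi> j)) / real (n l)\<bar> \<le> 1 / real (Suc (\<mu> l))"
    if "1 \<le> l" for l using P[OF that] unfolding P_def by blast+
  have lim: "(\<lambda>l. (\<Sum>i<n l. curve_error F (\<gamma> l i) (real l) \<Psi>) / real (n l)) \<longlonglongrightarrow> 0"
    if Psi: "\<Psi> \<in> C0_fields" for \<Psi>
  proof (rule tendstoI)
    fix e :: real assume e: "0 < e"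
    \<comment> \<open>Half of \<open>e\<close> pays for replacing \<open>\<Psi>\<close> by a dense
      field, the other half for the error on that field. The summand 1 covers
      \<open>measure_norm F = 0\<close>.\<close>
    define \<delta> where "\<delta> = e / (4 * (1 + measure_norm F))"
    have d: "0 < \<delta>" using e N by (simp add: \<delta>_def add_pos_nonneg)
    have "\<delta> * (4 * (1 + measure_norm F)) = e" using N by (simp add: \<delta>_def add_nonneg_eq_0_iff)
    then have d2: "2 * measure_norm F * \<delta> \<le> e / 2" using d by (simp add: algebra_simps)
    obtain j where j: "\<And>x. norm (\<Psi> x - \<Phi> j x) \<le> \<delta>" using dense[OF Psi d] by blast
    obtain m where m: "2 / e < real m" using reals_Archimedean2 by blast
    show "\<forall>\<^sub>F l in sequentially. dist ((\<Sum>i<n l. curve_error F (\<gamma> l i) (real l) \<Psi>) / real (n l)) 0 < e"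
      using eventually_ge_at_top[of 1] mu_ge[of "max (Suc j) m"]
    proof eventually_elim
      case (elim l)
      note l = elim(1)
      have nl: "0 < real (n l)" using n[OF l] by simp
      have "\<bar>curve_error F (\<gamma> l i) (real l) \<Psi> - curve_error F (\<gamma> l i) (real l) (\<Phi> j)\<bar> \<le> 2 * measure_norm F * \<delta>"
        if "i < n l" for i
        unfolding curve_error_diff[OF F(1) g[OF l that] Psi Phi]
        by (rule curve_error_bound[OF F(1) g[OF l that] C0_fields_diff[OF Psi Phi] j])
      then have "\<bar>\<Sum>i<n l. curve_error F (\<gamma> l i) (real l) \<Psi> - curve_error F (\<gamma> l i) (real l) (\<Phi> j)\<bar> \<le> (\<Sum>i<n l. e / 2)"
        using d2 by (intro order_trans[OF sum_abs] sum_mono) fastforce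
      then have "\<bar>(\<Sum>i<n l. curve_error F (\<gamma> l i) (real l) \<Psi>) / real (n l) -
          (\<Sum>i<n l. curve_error F (\<gamma> l i) (real l) (\<Phi> j)) / real (n l)\<bar> \<le> e / 2"
        using nl by (simp add: sum_subtractf flip: diff_divide_distrib) (simp add: abs_divide pos_divide_le_eq mult.commute)
      moreover have "\<bar>(\<Sum>i<n l. curve_error F (\<gamma> l i) (real l) (\<Phi> j)) / real (n l)\<bar> \<le> 1 / real (Suc (\<mu> l))"
        using elim(2) by (intro err[OF l]) simp
      moreover have "1 / real (Suc (\<mu> l)) < e / 2"
      proof -
        have "2 / e < real (Suc (\<mu> l))" using m elim(2) by simp
        then show ?thesis using e by (simp add: divide_simps mult.commute)
      qed
      ultimately show ?case unfolding dist_real_def diff_0_right by linarith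
    qed
  qed
  have conv: "(\<lambda>l. measure_norm F / (real (n l) * real l) *
     (\<Sum>i=1..n l. curve_measure (\<gamma> l (i - 1)) (real l) \<Psi>)) \<longlonglongrightarrow> F \<Psi>" if Psi: "\<Psi> \<in> C0_fields" for \<Psi>
  proof -
    have "(\<lambda>l. F \<Psi> - (\<Sum>i<n l. curve_error F (\<gamma> l i) (real l) \<Psi>) / real (n l)) \<longlonglongrightarrow> F \<Psi> - 0"
      by (intro tendsto_diff tendsto_const lim Psi)
    moreover have "\<forall>\<^sub>F l in sequentially. F \<Psi> - (\<Sum>i<n l. curve_error F (\<gamma> l i) (real l) \<Psi>) / real (n l) =
        measure_norm F / (real (n l) * real l) * (\<Sum>i=1..n l. curve_measure (\<gamma> l (i - 1)) (real l) \<Psi>)"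
      using eventually_ge_at_top[of 1]
    proof eventually_elim
      case (elim l)
      show ?case using curve_error_sum_eq[OF n[OF elim], of F "\<gamma> l" "real l" \<Psi>] by (simp add: sum.atLeast1_atMost_eq)
    qed
    ultimately show ?thesis by (simp add: tendsto_cong)
  qed
  have len: "(\<lambda>l. (\<Sum>i=1..n l. real l) / (real (n l) * real l)) \<longlonglongrightarrow> 1"
  proof (rule tendsto_eventually)
    show "\<forall>\<^sub>F l in sequentially. (\<Sum>i=1..n l. real l) / (real (n l) * real l) = 1"
      using eventually_ge_at_top[of 1] by eventually_elim (use n in auto)
  qed
  have curves: "n l > 0 \<and> (\<forall>i\<in>{1..n l}. real l \<le> real l \<and> real l \<le> 2 * real l \<and>
      arclength_C1_closed_curve (\<gamma> l (i - 1)) (real l))" if "1 \<le> l" for l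
    using n[OF that] g[OF that] by auto
  show ?thesis
    \<comment> \<open>The shift \<open>i - 1\<close> translates curves indexed from 0 to the range
      starting at 1. All lengths equal \<open>l\<close>, so the length ratio is exactly 1 for
      \<open>l \<ge> 1\<close>.\<close>
    by (rule exI[of _ n], rule exI[of _ "\<lambda>i l. \<gamma> l (i - 1)"], rule exI[of _ "\<lambda>i l. real l"])
      (use curves conv len in blast)
qed

end
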